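(* Let $1\to N\to G\xrightarrow{\pi}H\to1$ be a short exact sequence of groups with conjugation-invariant norms, where $\pi$ is Lipschitz. Consider the induced map $\hat{\mathcal{C}}(\pi)\colon\hat{\mathcal{C}}(G)\to\hat{\mathcal{C}}(H)$, $[g]\mapsto[\pi\circ g]$. (a) If $N$ is bounded in $G$ and if there exists a Lipschitz set-theoretic section $H\to G$ of $\pi$, then $\hat{\mathcal{C}}(\pi)$ is a bi-Lipschitz equivalence. In particular it is an isomorphism of groups. (b) If the metric on $H$ is the quotient metric induced from $G$ via $\pi$, i.e. $\|h\|_H=\inf\{\|g\|_G: g\in\pi^{-1}(h)\}$ for all $h\in H$, and if $N$ is bounded in $G$, then $\hat{\mathcal{C}}(\pi)$ is an isometry.
   Context: Norms. A norm on a group $G$ is a function $\|\cdot\|\colon G\to[0,\infty)$ with $\|g\|=0\iff g=1$, $\|g^{-1}\|=\|g\|$ and $\|gh\|\le\|g\|+\|h\|$; for a pseudonorm one only requires $\|1\|=0$ instead of the first condition. It is conjugation-invariant if $\|hgh^{-1}\|=\|g\|$ for all $g,h$. It induces the bi-invariant (pseudo)metric $d(g,h)=\|g^{-1}h\|$; all metric notions refer to it. A homomorphism $\varphi$ is Lipschitz with constant $C$ iff $\|\varphi(g)\|\le C\|g\|$ for all $g$. The groups $F_{\mathbb{R}}(G)$ and $F(G)$. Let $G$ be a group with a conjugation-invariant norm. $F_{\mathbb{R}}(G)$ is the free product of copies of the additive group $\mathbb{R}$ indexed by the elements $g$ of the set $G$; the element $r$ of the copy indexed by $g$ is written $\overline{g}(r)$.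 It carries the conjugation-invariant pseudonorm $$\|x\|=\inf\Big\{\sum_{i=1}^n |r_i|\,\|g_i\| : x=\prod_{i=1}^n h_i\,\overline{g_i}(r_i)^{\pm1}h_i^{-1},\ h_i\in F_{\mathbb{R}}(G)\Big\}.$$ $F(G)\le F_{\mathbb{R}}(G)$ is the subgroup generated by the elements $\overline{g}:=\overline{g}(1)$; it is free on $\{\overline{g}: g\in G\}$. For $t\in\mathbb{R}$, $\psi_t\colon F_{\mathbb{R}}(G)\to F_{\mathbb{R}}(G)$ is the homomorphism with $\psi_t(\overline{g}(r))=\overline{g}(tr)$. $\pi_G\colon F(G)\to G$ is the homomorphism with $\pi_G(\overline{g})=g$. Directional asymptotic cone. A scaling set is an unbounded subset $T\subseteq(0,\infty)$; limits over $t\in T$ are taken as $t\to\infty$. A function $f$ from $T$ to a pseudometric space is Cauchy if for every $\epsilon>0$, $d(f(t),f(t'))<\epsilon$ for all sufficiently large $t,t'\in T$. $\mathcal{D}(G,T)$ is the group (pointwise product) of all functions $w\colon T\to F(G)$ such that $t\mapsto\psi_{1/t}(w(t))\in F_{\mathbb{R}}(G)$ is Cauchy, with pseudonorm $\|w\|=\lim_{t\in T}\|\psi_{1/t}(w(t))\|$. $\mathcal{C}(G,T)=\{\pi_G\circ w: w\in\mathcal{D}(G,T)\}$, a group of functions $T\to G$, with pseudonorm $\|g\|=\inf\{\|w\|: w\in\mathcal{D}(G,T),\ \pi_G\circ w=g\}$. The directional asymptotic cone $\hat{\mathcal{C}}(G,T)$ is the quotient of $\mathcal{C}(G,T)$ by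 the normal subgroup of elements of pseudonorm $0$, with the induced conjugation-invariant norm; $[g]$ denotes the class of $g$. Write $\hat{\mathcal{C}}(G)=\hat{\mathcal{C}}(G,(0,\infty))$. Any Lipschitz homomorphism $\varphi\colon G\to H$ induces a well-defined Lipschitz homomorphism $\hat{\mathcal{C}}(\varphi)\colon\hat{\mathcal{C}}(G)\to\hat{\mathcal{C}}(H)$, $[g]\mapsto[\varphi\circ g]$. *)

theory Defs
  imports Complex_Main "HOL-Algebra.Product_Groups"
begin

section \<open>Groups with a conjugation-invariant norm\<close>

locale conj_normed_group = group G for G :: "('a, 'm) monoid_scheme" (structure) +
  fixes nrm :: "'a \<Rightarrow> real"
  assumes nrm_nonneg: "x \<in> carrier G \<Longrightarrow> 0 \<le> nrm x"
    and nrm_eq_0_iff: "x \<in> carrier G \<Longrightarrow> nrm x = 0 \<longleftrightarrow> x = \<one>"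
    and nrm_inv: "x \<in> carrier G \<Longrightarrow> nrm (inv x) = nrm x"
    and nrm_mult: "x \<in> carrier G \<Longrightarrow> y \<in> carrier G \<Longrightarrow> nrm (x \<otimes> y) \<le> nrm x + nrm y"
    and nrm_conj: "x \<in> carrier G \<Longrightarrow> y \<in> carrier G \<Longrightarrow> nrm (y \<otimes> x \<otimes> inv y) = nrm x"

definition nrm_dist :: "('a, 'm) monoid_scheme \<Rightarrow> ('a \<Rightarrow> real) \<Rightarrow> 'a \<Rightarrow> 'a \<Rightarrow> real" where
  "nrm_dist G nrm x y = nrm (inv\<^bsub>G\<^esub> x \<otimes>\<^bsub>G\<^esub> y)"

definition lipschitz_on_groups ::
  "('a, 'm) monoid_scheme \<Rightarrow> ('a \<Rightarrow> real) \<Rightarrow> ('b, 'k) monoid_scheme \<Rightarrow> ('b \<Rightarrow> real) \<Rightarrow> ('a \<Rightarrow> 'b) \<Rightarrow> bool" where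
  "lipschitz_on_groups G nG H nH f \<longleftrightarrow>
     f \<in> carrier G \<rightarrow> carrier H \<and>
     (\<exists>C. \<forall>x\<in>carrier G. \<forall>y\<in>carrier G. nrm_dist H nH (f x) (f y) \<le> C * nrm_dist G nG x y)"

definition bilipschitz_equivalence ::
  "('a, 'm) monoid_scheme \<Rightarrow> ('a \<Rightarrow> real) \<Rightarrow> ('b, 'k) monoid_scheme \<Rightarrow> ('b \<Rightarrow> real) \<Rightarrow> ('a \<Rightarrow> 'b) \<Rightarrow> bool" where
  "bilipschitz_equivalence G nG H nH f \<longleftrightarrow>
     bij_betw f (carrier G) (carrier H) \<and>
     lipschitz_on_groups G nG H nH f \<and>
     lipschitz_on_groups H nH G nG (inv_into (carrier G) f)"

text \<open>Isometries are taken to be surjective, i.e. isomorphisms of metric spaces.\<close>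

definition isometry_of_groups ::
  "('a, 'm) monoid_scheme \<Rightarrow> ('a \<Rightarrow> real) \<Rightarrow> ('b, 'k) monoid_scheme \<Rightarrow> ('b \<Rightarrow> real) \<Rightarrow> ('a \<Rightarrow> 'b) \<Rightarrow> bool" where
  "isometry_of_groups G nG H nH f \<longleftrightarrow>
     bij_betw f (carrier G) (carrier H) \<and>
     (\<forall>x\<in>carrier G. \<forall>y\<in>carrier G. nrm_dist H nH (f x) (f y) = nrm_dist G nG x y)"


section \<open>Free products\<close>

text \<open>
  Words over the disjoint union of the factors, modulo the congruence generated by
  deleting identity letters and by multiplying adjacent letters from the same factor.
\<close>

definition fp_words :: "'i set \<Rightarrow> ('i \<Rightarrow> ('b, 'k) monoid_scheme) \<Rightarrow> ('i \<times> 'b) list set" where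
  "fp_words I K = lists (SIGMA i:I. carrier (K i))"

inductive_set fp_rel :: "'i set \<Rightarrow> ('i \<Rightarrow> ('b, 'k) monoid_scheme) \<Rightarrow> (('i \<times> 'b) list \<times> ('i \<times> 'b) list) set"
  for I :: "'i set" and K :: "'i \<Rightarrow> ('b, 'k) monoid_scheme" where
  fp_refl: "u \<in> fp_words I K \<Longrightarrow> (u, u) \<in> fp_rel I K"
| fp_sym: "(u, v) \<in> fp_rel I K \<Longrightarrow> (v, u) \<in> fp_rel I K"
| fp_trans: "(u, v) \<in> fp_rel I K \<Longrightarrow> (v, w) \<in> fp_rel I K \<Longrightarrow> (u, w) \<in> fp_rel I K"
| fp_one: "u \<in> fp_words I K \<Longrightarrow> v \<in> fp_words I K \<Longrightarrow> i \<in> I \<Longrightarrow>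
    (u @ [(i, \<one>\<^bsub>K i\<^esub>)] @ v, u @ v) \<in> fp_rel I K"
| fp_mult: "u \<in> fp_words I K \<Longrightarrow> v \<in> fp_words I K \<Longrightarrow> i \<in> I \<Longrightarrow>
    a \<in> carrier (K i) \<Longrightarrow> b \<in> carrier (K i) \<Longrightarrow>
    (u @ [(i, a), (i, b)] @ v, u @ [(i, a \<otimes>\<^bsub>K i\<^esub> b)] @ v) \<in> fp_rel I K"

definition free_product :: "'i set \<Rightarrow> ('i \<Rightarrow> ('b, 'k) monoid_scheme) \<Rightarrow> ('i \<times> 'b) list set monoid" where
  "free_product I K =
     \<lparr>carrier = fp_words I K // fp_rel I K,
      monoid.mult = (\<lambda>A B. fp_rel I K `` {u @ v | u v. u \<in> A \<and> v \<in> B}),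
      one = fp_rel I K `` {[]}\<rparr>"


lemma fp_words_append [simp]: "u @ v \<in> fp_words I K \<longleftrightarrow> u \<in> fp_words I K \<and> v \<in> fp_words I K"
  by (auto simp: fp_words_def)

lemma fp_words_Nil [simp]: "[] \<in> fp_words I K"
  by (auto simp: fp_words_def)

lemma fp_words_Cons [simp]:
  "(i, a) # v \<in> fp_words I K \<longleftrightarrow> i \<in> I \<and> a \<in> carrier (K i) \<and> v \<in> fp_words I K"
  by (auto simp: fp_words_def)

lemma fp_rel_words:
  assumes "\<And>i. i \<in> I \<Longrightarrow> monoid (K i)" and "(u, v) \<in> fp_rel I K"
  shows "u \<in> fp_words I K \<and> v \<in> fp_words I K"
  using assms(2)
  by induction (auto simp: monoid.one_closed[OF assms(1)] monoid.m_closed[OF assms(1)])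

lemma fp_rel_equiv:
  assumes "\<And>i. i \<in> I \<Longrightarrow> monoid (K i)"
  shows "equiv (fp_words I K) (fp_rel I K)"
proof (rule equivI)
  show "fp_rel I K \<subseteq> fp_words I K \<times> fp_words I K"
    using fp_rel_words[of I K, OF assms] by auto
qed (auto intro: refl_onI symI transI fp_rel.intros)

lemma fp_rel_append_left:
  "(u, v) \<in> fp_rel I K \<Longrightarrow> w \<in> fp_words I K \<Longrightarrow> (w @ u, w @ v) \<in> fp_rel I K"
proof (induction rule: fp_rel.induct)
  case (fp_one u v i)
  then show ?case using fp_rel.fp_one[of "w @ u" I K v i] by simp
next
  case (fp_mult u v i a b)
  then show ?case using fp_rel.fp_mult[of "w @ u" I K v i a b] by simp
qed (auto intro: fp_rel.intros)

lemma fp_rel_append_right: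
  "(u, v) \<in> fp_rel I K \<Longrightarrow> w \<in> fp_words I K \<Longrightarrow> (u @ w, v @ w) \<in> fp_rel I K"
proof (induction rule: fp_rel.induct)
  case (fp_one u v i)
  then show ?case using fp_rel.fp_one[of u I K "v @ w" i] by simp
next
  case (fp_mult u v i a b)
  then show ?case using fp_rel.fp_mult[of u I K "v @ w" i a b] by simp
qed (auto intro: fp_rel.intros)

lemma free_product_mult:
  assumes K: "\<And>i. i \<in> I \<Longrightarrow> monoid (K i)"
    and u: "u \<in> fp_words I K" and v: "v \<in> fp_words I K"
  shows "fp_rel I K `` {u} \<otimes>\<^bsub>free_product I K\<^esub> fp_rel I K `` {v} = fp_rel I K `` {u @ v}"
proof -
  have "fp_rel I K `` {u' @ v' | u' v'. u' \<in> fp_rel I K `` {u} \<and> v' \<in> fp_rel I K `` {v}}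
        = fp_rel I K `` {u @ v}" (is "?L = ?R")
  proof
    show "?R \<subseteq> ?L" using u v by (blast intro: fp_refl)
    show "?L \<subseteq> ?R"
    proof
      fix z assume "z \<in> ?L"
      then obtain u' v' where *: "(u, u') \<in> fp_rel I K" "(v, v') \<in> fp_rel I K" "(u' @ v', z) \<in> fp_rel I K"
        by blast
      have "(u @ v, u' @ v) \<in> fp_rel I K" by (rule fp_rel_append_right[OF *(1) v])
      moreover have "(u' @ v, u' @ v') \<in> fp_rel I K"
        using fp_rel_append_left[OF *(2)] fp_rel_words[OF K *(1)] by blast
      ultimately show "z \<in> ?R" using *(3) by (blast intro: fp_trans)
    qed
  qed
  then show ?thesis by (simp add: free_product_def)
qed

lemma free_product_group:
  assumes K: "\<And>i. i \<in> I \<Longrightarrow> group (K i)"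
  shows "group (free_product I K)"
proof -
  have M: "\<And>i. i \<in> I \<Longrightarrow> monoid (K i)" using K group.is_monoid by blast
  note mult = free_product_mult[OF M, simplified]
  have car: "A \<in> carrier (free_product I K) \<longleftrightarrow> (\<exists>u\<in>fp_words I K. A = fp_rel I K `` {u})" for A
    by (auto simp: free_product_def quotient_def)
  have one: "\<one>\<^bsub>free_product I K\<^esub> = fp_rel I K `` {[]}" by (simp add: free_product_def)
  have inv: "\<exists>v\<in>fp_words I K. (v @ u, []) \<in> fp_rel I K" if "u \<in> fp_words I K" for u
    using that
  proof (induction u)
    case Nil
    have "([] @ [], []) \<in> fp_rel I K" by (auto intro: fp_refl)
    then show ?case by (intro bexI[of _ "[]"]) auto
  next
    case (Cons p u)
    obtain i a where p: "p = (i, a)" by force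
    with Cons.prems have i: "i \<in> I" "a \<in> carrier (K i)" and u: "u \<in> fp_words I K" by auto
    interpret group "K i" using K i by blast
    from Cons.IH u obtain v where v: "v \<in> fp_words I K" "(v @ u, []) \<in> fp_rel I K" by blast
    let ?b = "inv\<^bsub>K i\<^esub> a"
    have "(v @ [(i, ?b), (i, a)] @ u, v @ [(i, ?b \<otimes>\<^bsub>K i\<^esub> a)] @ u) \<in> fp_rel I K"
      using i u v by (intro fp_mult) auto
    moreover have "(v @ [(i, ?b \<otimes>\<^bsub>K i\<^esub> a)] @ u, v @ u) \<in> fp_rel I K"
      using i u v fp_one[of v I K u i] by simp
    ultimately have "((v @ [(i, ?b)]) @ p # u, []) \<in> fp_rel I K"
      using v(2) p by (auto intro: fp_trans)
    then show ?case using v i by (intro bexI[of _ "v @ [(i, ?b)]"]) auto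
  qed
  show ?thesis
  proof (rule groupI)
    fix A assume "A \<in> carrier (free_product I K)"
    then obtain u where u: "u \<in> fp_words I K" "A = fp_rel I K `` {u}" by (auto simp: car)
    from inv[OF u(1)] obtain v where v: "v \<in> fp_words I K" "(v @ u, []) \<in> fp_rel I K" by blast
    have "fp_rel I K `` {v @ u} = fp_rel I K `` {[]}"
      by (rule equiv_class_eq[OF fp_rel_equiv[OF M] v(2)])
    with u v show "\<exists>B\<in>carrier (free_product I K). B \<otimes>\<^bsub>free_product I K\<^esub> A = \<one>\<^bsub>free_product I K\<^esub>"
      by (intro bexI[of _ "fp_rel I K `` {v}"]) (auto simp: mult car one)
  qed (auto simp: car one mult intro!: bexI)
qed

section \<open>The groups \<open>F\<^sub>\<real>(G)\<close> and \<open>F(G)\<close>\<close>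

definition real_group :: "real monoid" where
  "real_group = \<lparr>carrier = UNIV, monoid.mult = (+), one = 0\<rparr>"

definition FR :: "('a, 'm) monoid_scheme \<Rightarrow> ('a \<times> real) list set monoid" where
  "FR G = free_product (carrier G) (\<lambda>_. real_group)"

definition FR_gen :: "('a, 'm) monoid_scheme \<Rightarrow> 'a \<Rightarrow> real \<Rightarrow> ('a \<times> real) list set" where
  "FR_gen G g r = fp_rel (carrier G) (\<lambda>_. real_group) `` {[(g, r)]}"

definition FR_norm :: "('a, 'm) monoid_scheme \<Rightarrow> ('a \<Rightarrow> real) \<Rightarrow> ('a \<times> real) list set \<Rightarrow> real" where
  "FR_norm G nrm x = Inf {(\<Sum>(h, g, r, e) \<leftarrow> ds. \<bar>r\<bar> * nrm g) | ds :: (_ \<times> 'a \<times> real \<times> int) list.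
     (\<forall>(h, g, r, e) \<in> set ds. h \<in> carrier (FR G) \<and> g \<in> carrier G \<and> e \<in> {1, -1}) \<and>
     x = foldr (\<otimes>\<^bsub>FR G\<^esub>)
           (map (\<lambda>(h, g, r, e). h \<otimes>\<^bsub>FR G\<^esub> (FR_gen G g r [^]\<^bsub>FR G\<^esub> e) \<otimes>\<^bsub>FR G\<^esub> inv\<^bsub>FR G\<^esub> h) ds)
           \<one>\<^bsub>FR G\<^esub>}"

text \<open>\<open>\<psi>\<^sub>t\<close> rescales every letter of a word by \<open>t\<close>.\<close>

definition psi :: "('a, 'm) monoid_scheme \<Rightarrow> real \<Rightarrow> ('a \<times> real) list set \<Rightarrow> ('a \<times> real) list set" where
  "psi G t A = fp_rel (carrier G) (\<lambda>_. real_group) `` (map (\<lambda>(g, r). (g, t * r)) ` A)"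

definition FZ :: "('a, 'm) monoid_scheme \<Rightarrow> ('a \<times> real) list set monoid" where
  "FZ G = subgroup_generated (FR G) ((\<lambda>g. FR_gen G g 1) ` carrier G)"

text \<open>\<open>\<pi>\<^sub>G\<close> is specified by its values on generators; existence and uniqueness are proved below.\<close>

definition piG :: "('a, 'm) monoid_scheme \<Rightarrow> ('a \<times> real) list set \<Rightarrow> 'a" where
  "piG G = (THE f. f \<in> hom (FZ G) G \<and> f \<in> extensional (carrier (FZ G)) \<and>
                  (\<forall>g\<in>carrier G. f (FR_gen G g 1) = g))"


lemma group_real_group: "group real_group"
  by (rule groupI) (auto simp: real_group_def intro: exI[of _ "- _"])

lemma FR_group: "group (FR G)"
  unfolding FR_def by (intro free_product_group group_real_group)

lemma carrier_FR_iff: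
  "A \<in> carrier (FR G) \<longleftrightarrow>
    (\<exists>u \<in> lists (carrier G \<times> UNIV). A = fp_rel (carrier G) (\<lambda>_. real_group) `` {u})"
  by (auto simp: FR_def free_product_def quotient_def fp_words_def real_group_def)

lemma FR_equiv: "equiv (lists (carrier G \<times> UNIV)) (fp_rel (carrier G) (\<lambda>_. real_group))"
  using fp_rel_equiv[of "carrier G" "\<lambda>_. real_group"] group.is_monoid[OF group_real_group]
  by (simp add: fp_words_def) (simp add: real_group_def)

lemma FR_mult:
  assumes "u \<in> lists (carrier G \<times> UNIV)" "v \<in> lists (carrier G \<times> UNIV)"
  shows "fp_rel (carrier G) (\<lambda>_. real_group) `` {u} \<otimes>\<^bsub>FR G\<^esub> fp_rel (carrier G) (\<lambda>_. real_group) `` {v}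
       = fp_rel (carrier G) (\<lambda>_. real_group) `` {u @ v}"
  unfolding FR_def using assms group.is_monoid[OF group_real_group]
  by (intro free_product_mult) (auto simp: fp_words_def, auto simp: real_group_def)

lemma FR_gen_hom: "g \<in> carrier G \<Longrightarrow> FR_gen G g \<in> hom real_group (FR G)"
proof (rule homI)
  fix r s assume g: "g \<in> carrier G"
  show "FR_gen G g r \<in> carrier (FR G)"
    using g by (auto simp: FR_gen_def carrier_FR_iff intro!: bexI[of _ "[(g, r)]"])
  have "([(g, r), (g, s)], [(g, r + s)]) \<in> fp_rel (carrier G) (\<lambda>_. real_group)"
    using fp_mult[of "[]" "carrier G" "\<lambda>_. real_group" "[]" g r s] g by (simp add: real_group_def)
  then show "FR_gen G g (r \<otimes>\<^bsub>real_group\<^esub> s) = FR_gen G g r \<otimes>\<^bsub>FR G\<^esub> FR_gen G g s"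
    using g equiv_class_eq[OF FR_equiv, of "[(g, r), (g, s)]" "[(g, r + s)]" G]
    by (simp add: FR_gen_def FR_mult) (simp add: real_group_def)
qed

lemma psi_class:
  assumes "u \<in> lists (carrier G \<times> UNIV)"
  shows "psi G t (fp_rel (carrier G) (\<lambda>_. real_group) `` {u})
       = fp_rel (carrier G) (\<lambda>_. real_group) `` {map (\<lambda>(g, r). (g, t * r)) u}"
proof -
  let ?R = "fp_rel (carrier G) (\<lambda>_. real_group)"
  let ?f = "map (\<lambda>(g, r). (g, t * r))"
  have W: "fp_words (carrier G) (\<lambda>_. real_group) = lists (carrier G \<times> UNIV)"
    by (auto simp: fp_words_def real_group_def)
  have f: "?f x \<in> fp_words (carrier G) (\<lambda>_. real_group)" if "x \<in> fp_words (carrier G) (\<lambda>_. real_group)" for x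
    using that by (auto simp: fp_words_def real_group_def)
  have r: "(?f x, ?f y) \<in> ?R" if "(x, y) \<in> ?R" for x y
    using that
  proof (induction rule: fp_rel.induct)
    case (fp_one u v i)
    then show ?case using fp_rel.fp_one[OF f f, of u v i] by (simp add: real_group_def)
  next
    case (fp_mult u v i a b)
    then show ?case using fp_rel.fp_mult[OF f f, of u v i "t * a" "t * b"]
      by (simp add: real_group_def distrib_left)
  qed (auto intro: fp_rel.intros f)
  show ?thesis
    unfolding psi_def using r assms fp_refl[of u "carrier G" "\<lambda>_. real_group"] W
    by (auto intro: fp_trans)
qed

lemma psi_hom: "psi G t \<in> hom (FR G) (FR G)"
proof (rule homI)
  have m: "map (\<lambda>(g, r). (g, t * r)) u \<in> lists (carrier G \<times> UNIV)"
    if "u \<in> lists (carrier G \<times> UNIV)" for u using that by auto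
  fix A assume "A \<in> carrier (FR G)"
  then obtain u where u: "u \<in> lists (carrier G \<times> UNIV)" "A = fp_rel (carrier G) (\<lambda>_. real_group) `` {u}"
    by (auto simp: carrier_FR_iff)
  then show "psi G t A \<in> carrier (FR G)" using m[OF u(1)] by (auto simp: psi_class carrier_FR_iff)
  fix B assume "B \<in> carrier (FR G)"
  then obtain v where v: "v \<in> lists (carrier G \<times> UNIV)" "B = fp_rel (carrier G) (\<lambda>_. real_group) `` {v}"
    by (auto simp: carrier_FR_iff)
  have "u @ v \<in> lists (carrier G \<times> UNIV)" using u v by simp
  then show "psi G t (A \<otimes>\<^bsub>FR G\<^esub> B) = psi G t A \<otimes>\<^bsub>FR G\<^esub> psi G t B"
    using u v m[OF u(1)] m[OF v(1)] by (simp add: psi_class FR_mult del: in_lists_conv_set append_in_lists_conv)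
qed

lemma psi_FR_gen: "g \<in> carrier G \<Longrightarrow> psi G t (FR_gen G g r) = FR_gen G g (t * r)"
  by (simp add: FR_gen_def psi_class)

text \<open>
  Existence of \<open>\<pi>\<^sub>G\<close>: the group \<open>F\<^sub>\<real>(G)\<close> acts on \<open>[0,1) \<times> G\<close>, the letter \<open>(g, r)\<close>
  sending \<open>(x, a)\<close> to \<open>(frac (x + r), g\<^bsup>\<lfloor>x + r\<rfloor>\<^esup> a)\<close>, and \<open>F(G)\<close> acts through left
  multiplication by elements of \<open>G\<close> on the second factor.
\<close>

lemma (in group) piG_ex1:
  "\<exists>!f. f \<in> hom (FZ G) G \<and> f \<in> extensional (carrier (FZ G)) \<and> (\<forall>g\<in>carrier G. f (FR_gen G g 1) = g)"
proof -
  let ?R = "fp_rel (carrier G) (\<lambda>_. real_group)"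
  let ?S = "{0..<1::real} \<times> carrier G"
  let ?B = "(\<lambda>g. FR_gen G g 1) ` carrier G"
  define st where "st = (\<lambda>(g, r) (x::real, a). (frac (x + r), g [^] \<lfloor>x + r\<rfloor> \<otimes> a))"
  interpret F: group "FR G" by (rule FR_group)
  have genF: "FR_gen G g r \<in> carrier (FR G)" if "g \<in> carrier G" for g r
    using hom_in_carrier[OF FR_gen_hom[OF that], of r] by (simp add: real_group_def)
  have car: "carrier (FZ G) = generate (FR G) ?B"
    using genF by (simp add: FZ_def carrier_subgroup_generated Int_absorb1 image_subset_iff)
  have multZ: "A \<otimes>\<^bsub>FZ G\<^esub> B = A \<otimes>\<^bsub>FR G\<^esub> B" for A B by (simp add: FZ_def subgroup_generated_def)
  have st_mem: "st (g, r) p \<in> ?S" if "g \<in> carrier G" "p \<in> ?S" for g r p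
    using that by (auto simp: st_def frac_lt_1)
  have fold_mem: "foldr st u p \<in> ?S" if "u \<in> lists (carrier G \<times> UNIV)" "p \<in> ?S" for u p
    using that
  proof (induction u)
    case (Cons q u)
    then show ?case using st_mem[of "fst q" "foldr st u p" "snd q"] by auto
  qed auto
  have W: "fp_words (carrier G) (\<lambda>_. real_group) = lists (carrier G \<times> UNIV)"
    by (auto simp: fp_words_def real_group_def)
  have st_one: "st (g, 0) p = p" if "p \<in> ?S" "g \<in> carrier G" for g p
  proof -
    obtain x a where p: "p = (x, a)" by force
    then have "\<lfloor>x\<rfloor> = 0" using that by (auto simp: floor_eq_iff)
    then show ?thesis using that p by (auto simp: st_def frac_eq)
  qed
  have st_mult: "st (g, r) (st (g, s) p) = st (g, r + s) p" if g: "p \<in> ?S" "g \<in> carrier G" for g r s p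
  proof -
    obtain x a where p: "p = (x, a)" by force
    have a: "a \<in> carrier G" using g p by auto
    have e: "frac (x + s) + r = (x + (r + s)) - of_int \<lfloor>x + s\<rfloor>" by (simp add: frac_def)
    have f: "\<lfloor>frac (x + s) + r\<rfloor> = \<lfloor>x + (r + s)\<rfloor> - \<lfloor>x + s\<rfloor>" unfolding e by simp
    have "frac (frac (x + s) + r) = frac (x + (r + s))" unfolding frac_def[of "frac _ + _"] f 
      by (simp add: frac_def)
    moreover have "g [^] (\<lfloor>x + (r + s)\<rfloor> - \<lfloor>x + s\<rfloor>) \<otimes> (g [^] \<lfloor>x + s\<rfloor> \<otimes> a) = g [^] \<lfloor>x + (r + s)\<rfloor> \<otimes> a"
      using g a by (simp add: m_assoc[symmetric] int_pow_mult[symmetric])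
    ultimately show ?thesis by (simp add: st_def p f)
  qed
  have inv: "\<forall>p\<in>?S. foldr st u p = foldr st v p" if "(u, v) \<in> ?R" for u v
    using that
  proof (induction rule: fp_rel.induct)
    case (fp_one u v i)
    then have "v \<in> lists (carrier G \<times> UNIV)" by (simp only: W)
    then have "st (i, 0) (foldr st v p) = foldr st v p" if "p \<in> ?S" for p
      using fold_mem that fp_one(3) by (intro st_one) auto
    then show ?case by (simp add: real_group_def)
  next
    case (fp_mult u v i a b)
    then have "v \<in> lists (carrier G \<times> UNIV)" by (simp only: W)
    then have "st (i, a) (st (i, b) (foldr st v p)) = st (i, a + b) (foldr st v p)" if "p \<in> ?S" for p
      using fold_mem that fp_mult(3) by (intro st_mult) auto
    then show ?case by (simp add: real_group_def)
  qed auto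
  define P where "P = (\<lambda>A c. c \<in> carrier G \<and>
     (\<exists>u\<in>lists (carrier G \<times> UNIV). A = ?R `` {u} \<and> (\<forall>(x, a)\<in>?S. foldr st u (x, a) = (x, c \<otimes> a))))"
  have P_unique: "c = d" if "P A c" "P A d" for A c d
  proof -
    from that obtain u v where u: "u \<in> lists (carrier G \<times> UNIV)" "A = ?R `` {u}"
        "foldr st u (0, \<one>) = (0, c \<otimes> \<one>)" and v: "A = ?R `` {v}" "foldr st v (0, \<one>) = (0, d \<otimes> \<one>)"
        "v \<in> lists (carrier G \<times> UNIV)"
        and cd: "c \<in> carrier G" "d \<in> carrier G"
      unfolding P_def by fastforce
    have "v \<in> ?R `` {u}" using fp_refl[of v "carrier G" "\<lambda>_. real_group"] v u W by auto
    then have "(u, v) \<in> ?R" by simp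
    then have "foldr st u (0, \<one>) = foldr st v (0, \<one>)" using inv by auto
    then show ?thesis using u v cd by auto
  qed
  have P_one: "P \<one>\<^bsub>FR G\<^esub> \<one>"
    unfolding P_def by (auto simp: FR_def free_product_def intro!: bexI[of _ "[]"])
  have P_mult: "P (A \<otimes>\<^bsub>FR G\<^esub> B) (c \<otimes> d)" if AB: "P A c" "P B d" for A B c d
  proof -
    from AB obtain u v where u: "u \<in> lists (carrier G \<times> UNIV)" "A = ?R `` {u}"
        "\<And>x a. (x, a)\<in>?S \<Longrightarrow> foldr st u (x, a) = (x, c \<otimes> a)" and v: "v \<in> lists (carrier G \<times> UNIV)" "B = ?R `` {v}"
        "\<And>x a. (x, a)\<in>?S \<Longrightarrow> foldr st v (x, a) = (x, d \<otimes> a)" and cd: "c \<in> carrier G" "d \<in> carrier G"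
      unfolding P_def by blast
    have "A \<otimes>\<^bsub>FR G\<^esub> B = ?R `` {u @ v}" using u v by (simp add: FR_mult)
    moreover have "foldr st (u @ v) (x, a) = (x, c \<otimes> d \<otimes> a)" if "(x, a) \<in> ?S" for x a
      using that u(3)[of x "d \<otimes> a"] v(3)[of x a] cd by (auto simp: m_assoc)
    ultimately show ?thesis unfolding P_def using u(1) v(1) cd
      by (intro conjI bexI[of _ "u @ v"]) auto
  qed
  have P_gen: "P (FR_gen G g 1) g" if "g \<in> carrier G" for g
  proof -
    have "st (g, 1) (x, a) = (x, g \<otimes> a)" if x: "(x, a) \<in> ?S" for x a
    proof -
      have "\<lfloor>x\<rfloor> = 0" using x by (auto simp: floor_eq_iff)
      then show ?thesis using x \<open>g \<in> carrier G\<close> by (auto simp: st_def frac_def int_pow_1)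
    qed
    then show ?thesis unfolding P_def FR_gen_def using that by (intro conjI bexI[of _ "[(g, 1)]"]) auto
  qed
  have inv_gen: "inv\<^bsub>FR G\<^esub> (FR_gen G g 1) = FR_gen G g (- 1)" if g: "g \<in> carrier G" for g
  proof (rule F.inv_equality)
    interpret h: group_hom real_group "FR G" "FR_gen G g"
      using FR_gen_hom[OF g] by (simp add: group_hom_def group_hom_axioms_def FR_group group_real_group)
    show "FR_gen G g (- 1) \<otimes>\<^bsub>FR G\<^esub> FR_gen G g 1 = \<one>\<^bsub>FR G\<^esub>"
      using h.hom_mult[of "-1" 1] h.hom_one by (simp add: real_group_def)
  qed (use g genF in auto)
  have P_inv: "P (inv\<^bsub>FR G\<^esub> (FR_gen G g 1)) (inv g)" if g: "g \<in> carrier G" for g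
  proof -
    have "st (g, - 1) (x, a) = (x, inv g \<otimes> a)" if x: "(x, a) \<in> ?S" for x a
    proof -
      have "\<lfloor>x - 1\<rfloor> = - 1" using x by (auto simp: floor_eq_iff)
      then show ?thesis using g x by (auto simp: st_def frac_def int_pow_neg int_pow_1)
    qed
    then have "P (FR_gen G g (- 1)) (inv g)" unfolding P_def FR_gen_def using g
      by (intro conjI bexI[of _ "[(g, - 1)]"]) auto
    then show ?thesis by (simp only: inv_gen[OF g])
  qed
  have P_ex: "\<exists>c. P A c" if "A \<in> carrier (FZ G)" for A
    using that unfolding car
    by (induction rule: generate.induct) (use P_one P_mult P_gen P_inv in blast)+
  define f where "f = restrict (\<lambda>A. THE c. P A c) (carrier (FZ G))"
  have f: "f A = c" if "P A c" "A \<in> carrier (FZ G)" for A c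
    using that P_unique by (auto simp: f_def intro!: the_equality)
  have FZ_m: "A \<otimes>\<^bsub>FR G\<^esub> B \<in> carrier (FZ G)" if "A \<in> carrier (FZ G)" "B \<in> carrier (FZ G)" for A B
    using that unfolding car by (rule generate.eng)
  have f_hom: "f \<in> hom (FZ G) G"
  proof (rule homI)
    fix A assume A: "A \<in> carrier (FZ G)"
    then obtain c where c: "P A c" using P_ex by blast
    then show "f A \<in> carrier G" using f[OF c A] by (simp add: P_def)
    fix B assume B: "B \<in> carrier (FZ G)"
    then obtain d where d: "P B d" using P_ex by blast
    show "f (A \<otimes>\<^bsub>FZ G\<^esub> B) = f A \<otimes> f B"
      unfolding multZ f[OF c A] f[OF d B] by (rule f[OF P_mult[OF c d] FZ_m[OF A B]])
  qed
  have f_gen: "\<forall>g\<in>carrier G. f (FR_gen G g 1) = g"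
    using f P_gen by (auto simp: car intro: generate.incl)
  show ?thesis
  proof (rule ex1I[of _ f])
    show "f \<in> hom (FZ G) G \<and> f \<in> extensional (carrier (FZ G)) \<and> (\<forall>g\<in>carrier G. f (FR_gen G g 1) = g)"
      using f_hom f_gen by (auto simp: f_def)
    fix k assume k: "k \<in> hom (FZ G) G \<and> k \<in> extensional (carrier (FZ G)) \<and> (\<forall>g\<in>carrier G. k (FR_gen G g 1) = g)"
    have gZ: "group (FZ G)" unfolding FZ_def by (rule F.group_subgroup_generated)
    interpret k: group_hom "FZ G" G k
      using k gZ by (simp add: group_hom_def group_hom_axioms_def is_group)
    interpret h: group_hom "FZ G" G f
      using f_hom gZ by (simp add: group_hom_def group_hom_axioms_def is_group)
    have "k A = f A" if "A \<in> generate (FR G) ?B" for A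
      using that
    proof (induction rule: generate.induct)
      case one
      have "\<one>\<^bsub>FR G\<^esub> = \<one>\<^bsub>FZ G\<^esub>" by (simp add: FZ_def)
      then show ?case using k.hom_one h.hom_one by simp
    next
      case (incl A)
      then show ?case using k f_gen by auto
    next
      case (inv A)
      then have A: "A \<in> carrier (FZ G)" by (simp add: car generate.incl)
      have "inv\<^bsub>FR G\<^esub> A = inv\<^bsub>FZ G\<^esub> A"
        using A unfolding FZ_def by (rule F.inv_subgroup_generated[symmetric])
      moreover have "k A = f A" using inv k f_gen by auto
      ultimately show ?case using A k.hom_inv h.hom_inv by simp
    next
      case (eng A B)
      then show ?case using k.hom_mult[of A B] h.hom_mult[of A B] by (simp add: car multZ)
    qed
    then show "k = f" using k by (intro extensionalityI[of _ "carrier (FZ G)"]) (auto simp: car f_def)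
  qed
qed

lemma (in group) piG_hom: "piG G \<in> hom (FZ G) G"
  and piG_gen: "g \<in> carrier G \<Longrightarrow> piG G (FR_gen G g 1) = g"
  using theI'[OF piG_ex1] by (auto simp: piG_def)


section \<open>The directional asymptotic cone\<close>

text \<open>
  Functions on \<open>T\<close> are extensional, as in \<^const>\<open>product_group\<close>. Limits over \<open>t \<in> T\<close>
  are along \<open>T\<close> as \<open>t \<rightarrow> \<infinity>\<close>; \<open>T\<close> is meant to be a scaling set, i.e. an unbounded set
  of positive reals.
\<close>

definition cauchy_along ::
  "('b, 'k) monoid_scheme \<Rightarrow> ('b \<Rightarrow> real) \<Rightarrow> real set \<Rightarrow> (real \<Rightarrow> 'b) \<Rightarrow> bool" where
  "cauchy_along K n T f \<longleftrightarrow>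
     (\<forall>\<epsilon>>0. \<exists>t\<^sub>0. \<forall>t\<in>T. \<forall>t'\<in>T. t \<ge> t\<^sub>0 \<longrightarrow> t' \<ge> t\<^sub>0 \<longrightarrow> nrm_dist K n (f t) (f t') < \<epsilon>)"

definition Dgroup ::
  "('a, 'm) monoid_scheme \<Rightarrow> ('a \<Rightarrow> real) \<Rightarrow> real set \<Rightarrow> (real \<Rightarrow> ('a \<times> real) list set) monoid" where
  "Dgroup G nrm T = (product_group T (\<lambda>_. FZ G))
     \<lparr>carrier := {w \<in> T \<rightarrow>\<^sub>E carrier (FZ G).
        cauchy_along (FR G) (FR_norm G nrm) T (\<lambda>t. psi G (1 / t) (w t))}\<rparr>"

definition Dnorm ::
  "('a, 'm) monoid_scheme \<Rightarrow> ('a \<Rightarrow> real) \<Rightarrow> real set \<Rightarrow> (real \<Rightarrow> ('a \<times> real) list set) \<Rightarrow> real" where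
  "Dnorm G nrm T w = Lim (inf at_top (principal T)) (\<lambda>t. FR_norm G nrm (psi G (1 / t) (w t)))"

definition Cgroup ::
  "('a, 'm) monoid_scheme \<Rightarrow> ('a \<Rightarrow> real) \<Rightarrow> real set \<Rightarrow> (real \<Rightarrow> 'a) monoid" where
  "Cgroup G nrm T = (product_group T (\<lambda>_. G))
     \<lparr>carrier := (\<lambda>w. restrict (piG G \<circ> w) T) ` carrier (Dgroup G nrm T)\<rparr>"

definition Cnorm ::
  "('a, 'm) monoid_scheme \<Rightarrow> ('a \<Rightarrow> real) \<Rightarrow> real set \<Rightarrow> (real \<Rightarrow> 'a) \<Rightarrow> real" where
  "Cnorm G nrm T g =
     Inf {Dnorm G nrm T w | w. w \<in> carrier (Dgroup G nrm T) \<and> restrict (piG G \<circ> w) T = g}"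

definition Cnull ::
  "('a, 'm) monoid_scheme \<Rightarrow> ('a \<Rightarrow> real) \<Rightarrow> real set \<Rightarrow> (real \<Rightarrow> 'a) set" where
  "Cnull G nrm T = {g \<in> carrier (Cgroup G nrm T). Cnorm G nrm T g = 0}"

definition dcone ::
  "('a, 'm) monoid_scheme \<Rightarrow> ('a \<Rightarrow> real) \<Rightarrow> real set \<Rightarrow> (real \<Rightarrow> 'a) set monoid" where
  "dcone G nrm T = Cgroup G nrm T Mod Cnull G nrm T"

definition cone_class ::
  "('a, 'm) monoid_scheme \<Rightarrow> ('a \<Rightarrow> real) \<Rightarrow> real set \<Rightarrow> (real \<Rightarrow> 'a) \<Rightarrow> (real \<Rightarrow> 'a) set" where
  "cone_class G nrm T g = Cnull G nrm T #>\<^bsub>Cgroup G nrm T\<^esub> g"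

text \<open>The common value of the pseudonorm on a class.\<close>

definition cone_norm ::
  "('a, 'm) monoid_scheme \<Rightarrow> ('a \<Rightarrow> real) \<Rightarrow> real set \<Rightarrow> (real \<Rightarrow> 'a) set \<Rightarrow> real" where
  "cone_norm G nrm T A = the_elem (Cnorm G nrm T ` A)"

text \<open>
  The map \<open>[g] \<mapsto> [\<phi> \<circ> g]\<close>. The union is over the classes \<open>[\<phi> \<circ> g]\<close> for all
  representatives \<open>g\<close> of \<open>A\<close>. Since distinct classes are disjoint, it is a single
  class only if these all coincide, so a statement that \<open>cone_map\<close> takes values in the
  cone of \<open>H\<close> contains the well-definedness of this map.
\<close>

definition cone_map ::
  "('b, 'k) monoid_scheme \<Rightarrow> ('b \<Rightarrow> real) \<Rightarrow> real set \<Rightarrow> ('a \<Rightarrow> 'b) \<Rightarrow> (real \<Rightarrow> 'a) set \<Rightarrow> (real \<Rightarrow> 'b) set" where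
  "cone_map H nH T \<phi> A = (\<Union>g\<in>A. cone_class H nH T (restrict (\<phi> \<circ> g) T))"

end

theory Submission
  imports Defs
begin

text \<open>
  Let \<open>\<pi> : G \<rightarrow> H\<close> be the epimorphism and let \<open>\<sigma>\<close> be a set-theoretic section of it with
  \<open>\<parallel>\<sigma>(h)\<parallel> \<le> b \<parallel>h\<parallel>\<close>. The free product \<open>F\<^sub>\<real>(G)\<close> is functorial in arbitrary maps of the set \<open>G\<close>, and the
  induced homomorphisms commute with the rescalings \<open>\<psi>\<^sub>t\<close> and multiply the pseudonorm by at most the factor by
  which the map multiplies norms (\<open>FR_map_psi\<close>, \<open>FR_map_norm_le\<close>). Hence not only \<open>\<pi>\<close> but also the
  non-homomorphism \<open>\<sigma>\<close> acts on the Cauchy functions that define the cone, and it does so as a section of the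
  action of \<open>\<pi>\<close>. What \<open>\<sigma>\<close> fails to respect is the evaluation of free words, \<open>\<pi>\<^sub>G\<close> and \<open>\<pi>\<^sub>H\<close>
  (compare \<open>piG_natural\<close>), and there the boundedness of \<open>N\<close> enters.

  Given \<open>g \<in> \<C>(G)\<close>, a lift \<open>v\<close> of \<open>\<pi> \<circ> g\<close> is turned by \<open>\<sigma>\<close> into a lift of a function \<open>g'\<close> with
  \<open>\<pi> \<circ> g' = \<pi> \<circ> g\<close>. The quotient of \<open>g'\<close> and \<open>g\<close> takes values in the bounded subgroup \<open>N\<close>, and bounded
  functions have lifts of norm zero: a single letter \<open>n\<close> is rescaled to an element of norm at most
  \<open>\<parallel>n\<parallel>/t\<close> (\<open>bounded_lift\<close>). Therefore \<open>\<parallel>g\<parallel> \<le> b \<parallel>\<pi> \<circ> g\<parallel>\<close>, while \<open>\<parallel>\<pi> \<circ> g\<parallel> \<le> a \<parallel>g\<parallel>\<close> for a Lipschitz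
  constant \<open>a\<close> of \<open>\<pi>\<close> (\<open>bounded_kernel_epi\<close>). Both bounds together say that the elements of pseudonorm
  zero correspond under \<open>\<pi>\<close>, so that the induced map of cones is a bi-Lipschitz isomorphism
  (\<open>quotient_map_iso\<close>, \<open>quotient_map_bilipschitz\<close>).

  For the bi-Lipschitz statement, \<open>\<sigma>\<close> is the given section, translated such that \<open>\<sigma>(1) = 1\<close>. If \<open>H\<close>
  carries the quotient metric, then \<open>a = 1\<close>, and by definition of
  the quotient metric there is for every \<open>b > 1\<close> a section with constant \<open>b\<close>; as the inequality
  \<open>\<parallel>g\<parallel> \<le> b \<parallel>\<pi> \<circ> g\<parallel>\<close> does not mention the section, \<open>b\<close> may tend to \<open>1\<close> in it.
\<close>

section \<open>Conjugation-invariant pseudonorms\<close>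

lemma (in group) inv_mult_cancel [simp]:
  assumes "x \<in> carrier G" "y \<in> carrier G"
  shows "inv x \<otimes> (x \<otimes> y) = y" and "x \<otimes> (inv x \<otimes> y) = y"
  using assms by (simp_all add: m_assoc[symmetric])

text \<open>
  The groups \<open>F\<^sub>\<real>(G)\<close>, \<open>\<D>(G,T)\<close> and \<open>\<C>(G,T)\<close> all carry such a pseudonorm, so the metric
  estimates and the passage to the quotient are done once for all of them.
\<close>

locale conj_pseudonormed_group = group K for K :: "('a, 'm) monoid_scheme" (structure) +
  fixes n :: "'a \<Rightarrow> real"
  assumes pn_one: "n \<one> = 0"
    and pn_inv: "x \<in> carrier K \<Longrightarrow> n (inv x) = n x"
    and pn_mult: "x \<in> carrier K \<Longrightarrow> y \<in> carrier K \<Longrightarrow> n (x \<otimes> y) \<le> n x + n y"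
    and pn_conj: "x \<in> carrier K \<Longrightarrow> y \<in> carrier K \<Longrightarrow> n (y \<otimes> x \<otimes> inv y) = n x"
begin

lemma pn_nonneg:
  assumes "x \<in> carrier K"
  shows "0 \<le> n x"
proof -
  have "n (x \<otimes> inv x) \<le> n x + n (inv x)" using assms by (intro pn_mult) auto
  then show ?thesis using assms by (simp add: pn_one pn_inv)
qed

lemma dist_nonneg: "x \<in> carrier K \<Longrightarrow> y \<in> carrier K \<Longrightarrow> 0 \<le> nrm_dist K n x y"
  by (simp add: nrm_dist_def pn_nonneg)

lemma dist_le_sum: "x \<in> carrier K \<Longrightarrow> y \<in> carrier K \<Longrightarrow> nrm_dist K n x y \<le> n x + n y"
  using pn_mult[of "inv x" y] by (simp add: nrm_dist_def pn_inv)

lemma dist_mult: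
  assumes "x \<in> carrier K" "x' \<in> carrier K" "y \<in> carrier K" "y' \<in> carrier K"
  shows "nrm_dist K n (x \<otimes> y) (x' \<otimes> y') \<le> nrm_dist K n x x' + nrm_dist K n y y'"
proof -
  have "inv (x \<otimes> y) \<otimes> (x' \<otimes> y') = (inv y \<otimes> (inv x \<otimes> x') \<otimes> inv (inv y)) \<otimes> (inv y \<otimes> y')"
    using assms by (simp add: inv_mult_group m_assoc)
  also have "n \<dots> \<le> n (inv y \<otimes> (inv x \<otimes> x') \<otimes> inv (inv y)) + n (inv y \<otimes> y')"
    using assms by (intro pn_mult) auto
  finally show ?thesis using assms by (simp only: nrm_dist_def pn_conj m_closed inv_closed)
qed

lemma dist_inv:
  assumes "x \<in> carrier K" "y \<in> carrier K"
  shows "nrm_dist K n (inv x) (inv y) = nrm_dist K n x y"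
proof -
  have "nrm_dist K n (inv x) (inv y) = n (x \<otimes> inv (inv x \<otimes> y) \<otimes> inv x)"
    using assms by (simp add: nrm_dist_def inv_mult_group m_assoc)
  also have "\<dots> = n (inv x \<otimes> y)" using assms by (simp only: pn_conj pn_inv m_closed inv_closed)
  finally show ?thesis by (simp add: nrm_dist_def)
qed

lemma norm_diff_le_dist:
  assumes "x \<in> carrier K" "y \<in> carrier K"
  shows "\<bar>n x - n y\<bar> \<le> nrm_dist K n x y"
proof -
  have "n (x \<otimes> (inv x \<otimes> y)) \<le> n x + n (inv x \<otimes> y)" using assms by (intro pn_mult) auto
  moreover have "n (y \<otimes> inv (inv x \<otimes> y)) \<le> n y + n (inv (inv x \<otimes> y))"
    using assms by (intro pn_mult) auto
  moreover have "x \<otimes> (inv x \<otimes> y) = y" "y \<otimes> inv (inv x \<otimes> y) = x"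
    using assms by (simp_all add: m_assoc[symmetric] inv_mult_group)
  ultimately show ?thesis using assms by (simp add: nrm_dist_def pn_inv)
qed

end

subsection \<open>Pseudonorms defined as infima of costs\<close>

text \<open>
  The pseudonorms on \<open>F\<^sub>\<real>(G)\<close> and on \<open>\<C>(G,T)\<close> are both infima: over the ways to write an element as a
  product of conjugates, and over the lifts to \<open>\<D>(G,T)\<close>. Here \<open>R x c\<close> reads "some presentation of \<open>x\<close>
  costs \<open>c\<close>"; the axioms say that presentations can be inverted, concatenated and conjugated.
\<close>

locale group_cost = group K for K :: "('a, 'm) monoid_scheme" (structure) +
  fixes R :: "'a \<Rightarrow> real \<Rightarrow> bool"
  assumes cost_ex: "x \<in> carrier K \<Longrightarrow> \<exists>c. R x c"
    and cost_nonneg: "R x c \<Longrightarrow> 0 \<le> c"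
    and cost_one: "R \<one> 0"
    and cost_inv: "x \<in> carrier K \<Longrightarrow> R x c \<Longrightarrow> R (inv x) c"
    and cost_mult: "x \<in> carrier K \<Longrightarrow> y \<in> carrier K \<Longrightarrow> R x c \<Longrightarrow> R y d \<Longrightarrow> \<exists>e\<le>c + d. R (x \<otimes> y) e"
    and cost_conj: "x \<in> carrier K \<Longrightarrow> y \<in> carrier K \<Longrightarrow> R x c \<Longrightarrow> R (y \<otimes> x \<otimes> inv y) c"
begin

lemma Inf_cost_le: "R x c \<Longrightarrow> Inf {c. R x c} \<le> c"
  by (rule cInf_lower) (auto intro!: bdd_belowI cost_nonneg)

lemma Inf_cost_less:
  assumes "x \<in> carrier K" "Inf {c. R x c} < a"
  shows "\<exists>c<a. R x c"
  using cInf_lessD[OF _ assms(2)] cost_ex[OF assms(1)] by auto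

text \<open>
  Lipschitz estimates for infima are proved presentation by presentation. The factor \<open>a = 0\<close> is
  admitted because a Lipschitz constant may vanish.
\<close>

lemma Inf_cost_mono:
  assumes x: "x \<in> carrier K" and a: "0 \<le> a" and le: "\<And>c. R x c \<Longrightarrow> L \<le> a * c"
  shows "L \<le> a * Inf {c. R x c}"
proof (cases "a = 0")
  case True
  then show ?thesis using cost_ex[OF x] le by auto
next
  case False
  then have "L / a \<le> Inf {c. R x c}"
    using a cost_ex[OF x] le by (intro cInf_greatest) (auto simp: field_simps)
  then show ?thesis using False a by (simp add: field_simps)
qed

lemma pseudonorm: "conj_pseudonormed_group K (\<lambda>x. Inf {c. R x c})"
proof (intro conj_pseudonormed_group.intro conj_pseudonormed_group_axioms.intro is_group)
  show "Inf {c. R \<one> c} = 0"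
    by (intro antisym Inf_cost_le cost_one cInf_greatest) (use cost_one cost_nonneg in auto)
next
  fix x assume x: "x \<in> carrier K"
  have "{c. R (inv x) c} = {c. R x c}" using cost_inv[OF x] cost_inv[of "inv x"] x by auto
  then show "Inf {c. R (inv x) c} = Inf {c. R x c}" by simp
next
  fix x y assume xy: "x \<in> carrier K" "y \<in> carrier K"
  have "R x c" if "R (y \<otimes> x \<otimes> inv y) c" for c
    using cost_conj[of "y \<otimes> x \<otimes> inv y" "inv y" c] that xy by (simp add: m_assoc)
  then have "{c. R (y \<otimes> x \<otimes> inv y) c} = {c. R x c}" using cost_conj[OF xy] by blast
  then show "Inf {c. R (y \<otimes> x \<otimes> inv y) c} = Inf {c. R x c}" by simp
next
  fix x y assume xy: "x \<in> carrier K" "y \<in> carrier K"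
  show "Inf {c. R (x \<otimes> y) c} \<le> Inf {c. R x c} + Inf {c. R y c}"
  proof (rule field_le_epsilon)
    fix \<epsilon> :: real assume "0 < \<epsilon>"
    then obtain c d where cd: "R x c" "R y d" "c < Inf {c. R x c} + \<epsilon>/2" "d < Inf {c. R y c} + \<epsilon>/2"
      using Inf_cost_less[OF xy(1), of "Inf {c. R x c} + \<epsilon>/2"]
        Inf_cost_less[OF xy(2), of "Inf {c. R y c} + \<epsilon>/2"] by auto
    obtain e where e: "e \<le> c + d" "R (x \<otimes> y) e" using cost_mult[OF xy cd(1,2)] by blast
    show "Inf {c. R (x \<otimes> y) c} \<le> Inf {c. R x c} + Inf {c. R y c} + \<epsilon>"
      using Inf_cost_le[OF e(2)] cd(3,4) e(1) by simp
  qed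
qed

end

subsection \<open>Quotients by the elements of pseudonorm zero\<close>

definition nullset :: "('a, 'm) monoid_scheme \<Rightarrow> ('a \<Rightarrow> real) \<Rightarrow> 'a set" where
  "nullset K n = {x \<in> carrier K. n x = 0}"

definition quotient_norm :: "('a \<Rightarrow> real) \<Rightarrow> 'a set \<Rightarrow> real" where
  "quotient_norm n A = the_elem (n ` A)"

definition quotient_map ::
  "('b, 'k) monoid_scheme \<Rightarrow> ('b \<Rightarrow> real) \<Rightarrow> ('a \<Rightarrow> 'b) \<Rightarrow> 'a set \<Rightarrow> 'b set" where
  "quotient_map L m f A = (\<Union>x\<in>A. nullset L m #>\<^bsub>L\<^esub> f x)"

context conj_pseudonormed_group
begin

lemma nullset_normal: "nullset K n \<lhd> K"
proof -
  have "n (x \<otimes> y) = 0" if "x \<in> carrier K" "y \<in> carrier K" "n x = 0" "n y = 0" for x y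
    using that pn_mult[of x y] pn_nonneg[of "x \<otimes> y"] by simp
  then have "subgroup (nullset K n) K"
    by unfold_locales (auto simp: nullset_def pn_one pn_inv)
  then show ?thesis by (auto simp: normal_inv_iff nullset_def pn_conj)
qed

text \<open>
  Multiplying by an element of pseudonorm zero does not change the pseudonorm, hence the image
  of a coset under \<open>n\<close> is a singleton.
\<close>

lemma coset_norm:
  assumes x: "x \<in> carrier K"
  shows "quotient_norm n (nullset K n #> x) = n x"
proof -
  have "n (h \<otimes> x) = n x" if "h \<in> carrier K" "n h = 0" for h
  proof -
    have "inv h \<otimes> (h \<otimes> x) = x" using that x by (simp add: m_assoc[symmetric])
    then show ?thesis using that x pn_mult[of h x] pn_mult[of "inv h" "h \<otimes> x"] by (simp add: pn_inv)
  qed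
  moreover have "x \<in> nullset K n #> x"
    using x nullset_normal rcos_self normal_imp_subgroup by blast
  ultimately have "n ` (nullset K n #> x) = {n x}"
    by (fastforce simp: r_coset_def nullset_def)
  then show ?thesis by (simp add: quotient_norm_def)
qed

lemma quotient_dist:
  assumes "x \<in> carrier K" "y \<in> carrier K"
  shows "nrm_dist (K Mod nullset K n) (quotient_norm n) (nullset K n #> x) (nullset K n #> y)
       = nrm_dist K n x y"
proof -
  interpret N: normal "nullset K n" K by (rule nullset_normal)
  have "nullset K n #> x \<in> carrier (K Mod nullset K n)" using assms by (auto simp: carrier_FactGroup)
  then have "inv\<^bsub>K Mod nullset K n\<^esub> (nullset K n #> x) = nullset K n #> inv x"
    using assms by (simp add: N.inv_FactGroup N.rcos_inv)
  then show ?thesis using assms by (simp add: nrm_dist_def N.rcos_sum coset_norm)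
qed

lemma coset_eq_iff:
  assumes "x \<in> carrier K" "y \<in> carrier K"
  shows "nullset K n #> x = nullset K n #> y \<longleftrightarrow> nrm_dist K n x y = 0"
proof
  assume "nullset K n #> x = nullset K n #> y"
  then have "nrm_dist K n x y = nrm_dist K n y y"
    using quotient_dist[OF assms] quotient_dist[OF assms(2) assms(2)] by simp
  then show "nrm_dist K n x y = 0" using assms by (simp add: nrm_dist_def pn_one)
next
  interpret N: normal "nullset K n" K by (rule nullset_normal)
  assume "nrm_dist K n x y = 0"
  then have "nrm_dist K n (inv x) (inv y) = 0" by (simp only: dist_inv[OF assms])
  then have "x \<otimes> inv y \<in> nullset K n" using assms
    by (simp only: nullset_def nrm_dist_def inv_inv mem_Collect_eq m_closed inv_closed simp_thms)
  then have "x \<in> nullset K n #> y" using assms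
    by (auto simp: r_coset_def m_assoc intro!: bexI[of _ "x \<otimes> inv y"])
  then show "nullset K n #> x = nullset K n #> y"
    using repr_independence[OF _ assms(2) N.subgroup_axioms] by simp
qed

end

text \<open>
  The abstract form of the theorem: an epimorphism which distorts pseudonorms by bounded factors
  in both directions has exactly the elements of pseudonorm zero over those of pseudonorm zero, and
  so descends to a bijection of the quotients with the same distortion.
\<close>

locale pseudonormed_epi =
  K: conj_pseudonormed_group K n + L: conj_pseudonormed_group L m
  for K :: "('a, 'm) monoid_scheme" and n :: "'a \<Rightarrow> real"
    and L :: "('b, 'k) monoid_scheme" and m :: "'b \<Rightarrow> real" +
  fixes f :: "'a \<Rightarrow> 'b" and a b :: real
  assumes f_epi: "f \<in> epi K L"
    and upper: "x \<in> carrier K \<Longrightarrow> m (f x) \<le> a * n x"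
    and lower: "x \<in> carrier K \<Longrightarrow> n x \<le> b * m (f x)"
begin

abbreviation "KQ \<equiv> K Mod nullset K n"
abbreviation "LQ \<equiv> L Mod nullset L m"

lemma f_hom: "f \<in> hom K L" and f_surj: "f ` carrier K = carrier L"
  using f_epi by (auto simp: epi_def)

sublocale hom: group_hom K L f
  using f_hom by unfold_locales

lemma dist_upper: "x \<in> carrier K \<Longrightarrow> y \<in> carrier K \<Longrightarrow> nrm_dist L m (f x) (f y) \<le> a * nrm_dist K n x y"
  using upper[of "inv\<^bsub>K\<^esub> x \<otimes>\<^bsub>K\<^esub> y"] by (simp add: nrm_dist_def)

lemma dist_lower: "x \<in> carrier K \<Longrightarrow> y \<in> carrier K \<Longrightarrow> nrm_dist K n x y \<le> b * nrm_dist L m (f x) (f y)"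
  using lower[of "inv\<^bsub>K\<^esub> x \<otimes>\<^bsub>K\<^esub> y"] by (simp add: nrm_dist_def)

lemma dist_zero_iff:
  assumes "x \<in> carrier K" "y \<in> carrier K"
  shows "nrm_dist L m (f x) (f y) = 0 \<longleftrightarrow> nrm_dist K n x y = 0"
  using dist_upper[OF assms] dist_lower[OF assms] K.dist_nonneg[OF assms] L.dist_nonneg[of "f x" "f y"] assms
  by auto

lemma quotient_map_coset:
  assumes x: "x \<in> carrier K"
  shows "quotient_map L m f (nullset K n #>\<^bsub>K\<^esub> x) = nullset L m #>\<^bsub>L\<^esub> f x"
proof -
  interpret N: normal "nullset K n" K by (rule K.nullset_normal)
  have cl: "nullset L m #>\<^bsub>L\<^esub> f y = nullset L m #>\<^bsub>L\<^esub> f x" if y: "y \<in> nullset K n #>\<^bsub>K\<^esub> x" for y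
  proof -
    have yc: "y \<in> carrier K" using y x K.r_coset_subset_G[OF N.subset] by blast
    have "nullset K n #>\<^bsub>K\<^esub> y = nullset K n #>\<^bsub>K\<^esub> x"
      by (rule K.repr_independence[OF y x N.subgroup_axioms, symmetric])
    then show ?thesis using x yc by (simp add: K.coset_eq_iff L.coset_eq_iff dist_zero_iff)
  qed
  have "nullset K n #>\<^bsub>K\<^esub> x \<noteq> {}" using K.rcos_self[OF x N.subgroup_axioms] by blast
  then show ?thesis unfolding quotient_map_def by (rule SUP_eq_const) (rule cl)
qed

lemma coset_cases:
  assumes "A \<in> carrier KQ"
  obtains x where "x \<in> carrier K" "A = nullset K n #>\<^bsub>K\<^esub> x"
  using assms unfolding carrier_FactGroup by (elim imageE)

lemma quotient_map_iso: "quotient_map L m f \<in> iso KQ LQ"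
proof (rule isoI)
  show "quotient_map L m f \<in> hom KQ LQ"
  proof (rule homI)
    fix A assume "A \<in> carrier KQ"
    then obtain x where "x \<in> carrier K" "A = nullset K n #>\<^bsub>K\<^esub> x" by (rule coset_cases)
    then show "quotient_map L m f A \<in> carrier LQ"
      by (simp add: quotient_map_coset carrier_FactGroup)
  next
    fix A B assume "A \<in> carrier KQ" "B \<in> carrier KQ"
    then obtain x y where "x \<in> carrier K" "A = nullset K n #>\<^bsub>K\<^esub> x" "y \<in> carrier K" "B = nullset K n #>\<^bsub>K\<^esub> y"
      using coset_cases[of A] coset_cases[of B] by metis
    then show "quotient_map L m f (A \<otimes>\<^bsub>KQ\<^esub> B) = quotient_map L m f A \<otimes>\<^bsub>LQ\<^esub> quotient_map L m f B"
      by (simp add: quotient_map_coset normal.rcos_sum[OF K.nullset_normal] normal.rcos_sum[OF L.nullset_normal])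
  qed
  show "bij_betw (quotient_map L m f) (carrier KQ) (carrier LQ)"
    unfolding bij_betw_def
  proof
    show "inj_on (quotient_map L m f) (carrier KQ)"
    proof (rule inj_onI)
      fix A B assume AB: "A \<in> carrier KQ" "B \<in> carrier KQ" "quotient_map L m f A = quotient_map L m f B"
      then obtain x y where "x \<in> carrier K" "A = nullset K n #>\<^bsub>K\<^esub> x" "y \<in> carrier K" "B = nullset K n #>\<^bsub>K\<^esub> y"
      using coset_cases[of A] coset_cases[of B] by metis
      then show "A = B" using AB(3)
        by (simp add: quotient_map_coset K.coset_eq_iff L.coset_eq_iff dist_zero_iff)
    qed
    have "quotient_map L m f ` carrier KQ = (\<lambda>x. nullset L m #>\<^bsub>L\<^esub> f x) ` carrier K"
      unfolding carrier_FactGroup image_image by (intro image_cong refl quotient_map_coset)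
    also have "\<dots> = (\<lambda>y. nullset L m #>\<^bsub>L\<^esub> y) ` f ` carrier K" by (simp only: image_image)
    also have "\<dots> = carrier LQ" by (simp only: f_surj carrier_FactGroup)
    finally show "quotient_map L m f ` carrier KQ = carrier LQ" .
  qed
qed

lemma quotient_dist_bounds:
  assumes "A \<in> carrier KQ" "B \<in> carrier KQ"
  shows "nrm_dist LQ (quotient_norm m) (quotient_map L m f A) (quotient_map L m f B)
           \<le> a * nrm_dist KQ (quotient_norm n) A B"
    and "nrm_dist KQ (quotient_norm n) A B
           \<le> b * nrm_dist LQ (quotient_norm m) (quotient_map L m f A) (quotient_map L m f B)"
proof -
  obtain x y where xy: "x \<in> carrier K" "y \<in> carrier K"
      and A: "A = nullset K n #>\<^bsub>K\<^esub> x" and B: "B = nullset K n #>\<^bsub>K\<^esub> y"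
    using coset_cases[OF assms(1)] coset_cases[OF assms(2)] by metis
  have "nrm_dist LQ (quotient_norm m) (quotient_map L m f A) (quotient_map L m f B) = nrm_dist L m (f x) (f y)"
    unfolding A B using xy by (simp only: quotient_map_coset L.quotient_dist hom.hom_closed)
  moreover have "nrm_dist KQ (quotient_norm n) A B = nrm_dist K n x y"
    unfolding A B using xy by (rule K.quotient_dist)
  ultimately show "nrm_dist LQ (quotient_norm m) (quotient_map L m f A) (quotient_map L m f B)
           \<le> a * nrm_dist KQ (quotient_norm n) A B"
    and "nrm_dist KQ (quotient_norm n) A B
           \<le> b * nrm_dist LQ (quotient_norm m) (quotient_map L m f A) (quotient_map L m f B)"
    using dist_upper[OF xy] dist_lower[OF xy] by simp_all
qed

lemma quotient_map_bilipschitz: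
  "bilipschitz_equivalence KQ (quotient_norm n) LQ (quotient_norm m) (quotient_map L m f)"
proof -
  let ?F = "quotient_map L m f"
  have bij: "bij_betw ?F (carrier KQ) (carrier LQ)" using quotient_map_iso by (simp add: iso_def)
  have "nrm_dist KQ (quotient_norm n) (inv_into (carrier KQ) ?F A) (inv_into (carrier KQ) ?F B)
          \<le> b * nrm_dist LQ (quotient_norm m) A B" if "A \<in> carrier LQ" "B \<in> carrier LQ" for A B
    using quotient_dist_bounds(2)[of "inv_into (carrier KQ) ?F A" "inv_into (carrier KQ) ?F B"]
      that bij_betw_inv_into_right[OF bij] bij_betw_apply[OF bij_betw_inv_into[OF bij]] by simp
  then show ?thesis
    unfolding bilipschitz_equivalence_def lipschitz_on_groups_def
    using bij quotient_dist_bounds(1) bij_betw_imp_funcset[OF bij]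
      bij_betw_imp_funcset[OF bij_betw_inv_into[OF bij]] by blast
qed

text \<open>
  Equality of pseudonorms is the case of both constants being \<open>1\<close>. The constants \<open>a\<close> and \<open>b\<close> of the
  locale are kept apart from this because the lower bound with constant \<open>1\<close> may only be available as a
  limit of bounds with larger constants.
\<close>

lemma quotient_map_isometry:
  assumes "\<And>x. x \<in> carrier K \<Longrightarrow> m (f x) = n x"
  shows "isometry_of_groups KQ (quotient_norm n) LQ (quotient_norm m) (quotient_map L m f)"
proof -
  interpret I: pseudonormed_epi K n L m f 1 1
    by unfold_locales (simp_all add: f_epi assms)
  show ?thesis
    unfolding isometry_of_groups_def
    using quotient_map_iso I.quotient_dist_bounds by (simp add: iso_def order_antisym)
qed

end

section \<open>The free product of copies of the reals\<close>

lemma FR_words: "fp_words (carrier G) (\<lambda>_. real_group) = lists (carrier G \<times> UNIV)"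
  by (auto simp: fp_words_def real_group_def)

lemma FR_gen_closed: "g \<in> carrier G \<Longrightarrow> FR_gen G g r \<in> carrier (FR G)"
  using hom_in_carrier[OF FR_gen_hom, of g G r] by (simp add: real_group_def)

lemma FR_one: "\<one>\<^bsub>FR G\<^esub> = fp_rel (carrier G) (\<lambda>_. real_group) `` {[]}"
  by (simp add: FR_def free_product_def)

lemma FR_Cons:
  assumes "g \<in> carrier G" "u \<in> lists (carrier G \<times> UNIV)"
  shows "fp_rel (carrier G) (\<lambda>_. real_group) `` {(g, r) # u}
       = FR_gen G g r \<otimes>\<^bsub>FR G\<^esub> fp_rel (carrier G) (\<lambda>_. real_group) `` {u}"
  using FR_mult[of "[(g, r)]" G u] assms by (simp add: FR_gen_def)

text \<open>
  Every element is represented by a word, so it can be built up letter by letter from the left.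
\<close>

lemma FR_induct [consumes 1, case_names one gen]:
  assumes "A \<in> carrier (FR G)"
    and one: "P \<one>\<^bsub>FR G\<^esub>"
    and gen: "\<And>g r x. g \<in> carrier G \<Longrightarrow> x \<in> carrier (FR G) \<Longrightarrow> P x \<Longrightarrow> P (FR_gen G g r \<otimes>\<^bsub>FR G\<^esub> x)"
  shows "P A"
proof -
  obtain u where u: "u \<in> lists (carrier G \<times> UNIV)" "A = fp_rel (carrier G) (\<lambda>_. real_group) `` {u}"
    using assms(1) by (auto simp: carrier_FR_iff)
  have "P (fp_rel (carrier G) (\<lambda>_. real_group) `` {u})" using u(1)
  proof (induction u)
    case Nil
    then show ?case using one by (simp add: FR_one)
  next
    case (Cons p u)
    obtain g r where p: "p = (g, r)" by force
    have g: "g \<in> carrier G" using Cons.hyps(1) p by simp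
    have "fp_rel (carrier G) (\<lambda>_. real_group) `` {u} \<in> carrier (FR G)"
      using Cons.hyps(2) carrier_FR_iff by blast
    then show ?case unfolding p FR_Cons[OF g Cons.hyps(2)] by (rule gen[OF g _ Cons.IH])
  qed
  then show ?thesis by (simp only: u(2))
qed

lemma FR_gen_zero:
  assumes "g \<in> carrier G"
  shows "FR_gen G g 0 = \<one>\<^bsub>FR G\<^esub>"
proof -
  interpret h: group_hom real_group "FR G" "FR_gen G g"
    using FR_gen_hom[OF assms] by (simp add: group_hom_def group_hom_axioms_def FR_group group_real_group)
  show ?thesis using h.hom_one by (simp add: real_group_def)
qed

lemma inv_FR_gen:
  assumes "g \<in> carrier G"
  shows "inv\<^bsub>FR G\<^esub> FR_gen G g r = FR_gen G g (- r)"
proof -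
  have "FR_gen G g (- r) \<otimes>\<^bsub>FR G\<^esub> FR_gen G g r = FR_gen G g (- r + r)"
    using hom_mult[OF FR_gen_hom[OF assms], of "- r" r] by (simp add: real_group_def)
  then show ?thesis
    using assms by (intro group.inv_equality FR_group FR_gen_closed) (simp_all add: FR_gen_zero)
qed

subsection \<open>The pseudonorm\<close>

text \<open>
  A product of conjugates of letters \<open>g(r)\<close>, built from the right, with its cost. The exponents
  \<open>\<plusminus>1\<close> of the defining formula of the pseudonorm are absorbed into the sign of \<open>r\<close>, as
  \<open>g(r)\<^sup>-\<^sup>1 = g(-r)\<close> has the same cost.
\<close>

inductive FR_cost ::
  "('a, 'm) monoid_scheme \<Rightarrow> ('a \<Rightarrow> real) \<Rightarrow> ('a \<times> real) list set \<Rightarrow> real \<Rightarrow> bool"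
  for G :: "('a, 'm) monoid_scheme" and nrm :: "'a \<Rightarrow> real" where
  FR_cost_one: "FR_cost G nrm \<one>\<^bsub>FR G\<^esub> 0"
| FR_cost_step: "h \<in> carrier (FR G) \<Longrightarrow> g \<in> carrier G \<Longrightarrow> FR_cost G nrm x c \<Longrightarrow>
    FR_cost G nrm (h \<otimes>\<^bsub>FR G\<^esub> FR_gen G g r \<otimes>\<^bsub>FR G\<^esub> inv\<^bsub>FR G\<^esub> h \<otimes>\<^bsub>FR G\<^esub> x) (\<bar>r\<bar> * nrm g + c)"

lemma FR_norm_eq_Inf_cost: "FR_norm G nrm x = Inf {c. FR_cost G nrm x c}"
proof -
  interpret F: group "FR G" by (rule FR_group)
  let ?ok = "\<lambda>ds :: (_ \<times> _ \<times> real \<times> int) list.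
    \<forall>(h, g, r, e) \<in> set ds. h \<in> carrier (FR G) \<and> g \<in> carrier G \<and> e \<in> {1, -1}"
  let ?cost = "\<lambda>ds :: (_ \<times> _ \<times> real \<times> int) list. \<Sum>(h, g, r, e) \<leftarrow> ds. \<bar>r\<bar> * nrm g"
  let ?prod = "\<lambda>ds :: (_ \<times> _ \<times> real \<times> int) list. foldr (\<otimes>\<^bsub>FR G\<^esub>)
     (map (\<lambda>(h, g, r, e). h \<otimes>\<^bsub>FR G\<^esub> (FR_gen G g r [^]\<^bsub>FR G\<^esub> e) \<otimes>\<^bsub>FR G\<^esub> inv\<^bsub>FR G\<^esub> h) ds) \<one>\<^bsub>FR G\<^esub>"
  have "FR_cost G nrm (?prod ds) (?cost ds)" if "?ok ds" for ds
    using that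
  proof (induction ds)
    case Nil
    then show ?case by (simp add: FR_cost_one)
  next
    case (Cons d ds)
    obtain h g r e where d: "d = (h, g, r, e)" by (metis surj_pair)
    have hg: "h \<in> carrier (FR G)" "g \<in> carrier G" and e: "e = 1 \<or> e = -1"
      and IH: "FR_cost G nrm (?prod ds) (?cost ds)"
      using Cons d by auto
    show ?case
      using e
    proof
      assume "e = 1"
      then show ?thesis
        using FR_cost_step[OF hg IH, of r] by (simp add: d hg FR_gen_closed F.int_pow_1)
    next
      assume "e = -1"
      then have "FR_gen G g r [^]\<^bsub>FR G\<^esub> e = FR_gen G g (- r)"
        using hg by (simp add: F.int_pow_neg F.int_pow_1 FR_gen_closed inv_FR_gen)
      then show ?thesis using FR_cost_step[OF hg IH, of "- r"] by (simp add: d)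
    qed
  qed
  moreover have "\<exists>ds. ?ok ds \<and> y = ?prod ds \<and> c = ?cost ds" if "FR_cost G nrm y c" for y c
    using that
  proof induction
    case FR_cost_one
    show ?case by (rule exI[of _ "[]"]) simp
  next
    case (FR_cost_step h g y c r)
    then obtain ds where "?ok ds" "y = ?prod ds" "c = ?cost ds" by blast
    with FR_cost_step show ?case
      by (intro exI[of _ "(h, g, r, 1) # ds"]) (auto simp: F.int_pow_1 FR_gen_closed)
  qed
  ultimately have "{?cost ds | ds. ?ok ds \<and> x = ?prod ds} = {c. FR_cost G nrm x c}" by blast
  then show ?thesis by (simp only: FR_norm_def)
qed

lemma FR_cost_closed: "FR_cost G nrm x c \<Longrightarrow> x \<in> carrier (FR G)"
proof (induction rule: FR_cost.induct)
  interpret F: group "FR G" by (rule FR_group)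
  case (FR_cost_step h g x c r)
  then show ?case by (simp add: FR_gen_closed)
qed (simp add: group.is_monoid[OF FR_group] monoid.one_closed)

lemma FR_cost_conj_gen:
  assumes "h \<in> carrier (FR G)" "g \<in> carrier G"
  shows "FR_cost G nrm (h \<otimes>\<^bsub>FR G\<^esub> FR_gen G g r \<otimes>\<^bsub>FR G\<^esub> inv\<^bsub>FR G\<^esub> h) (\<bar>r\<bar> * nrm g)"
proof -
  interpret F: group "FR G" by (rule FR_group)
  show ?thesis
    using FR_cost_step[OF assms FR_cost_one, of nrm r] assms by (simp add: FR_gen_closed)
qed

lemma FR_cost_gen: "g \<in> carrier G \<Longrightarrow> FR_cost G nrm (FR_gen G g r) (\<bar>r\<bar> * nrm g)"
proof -
  interpret F: group "FR G" by (rule FR_group)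
  assume "g \<in> carrier G"
  then show ?thesis using FR_cost_conj_gen[of "\<one>\<^bsub>FR G\<^esub>" G g nrm r] by (simp add: FR_gen_closed)
qed

lemma FR_cost_mult:
  assumes "FR_cost G nrm x c" "FR_cost G nrm y d"
  shows "FR_cost G nrm (x \<otimes>\<^bsub>FR G\<^esub> y) (c + d)"
  using assms(1)
proof induction
  interpret F: group "FR G" by (rule FR_group)
  have y: "y \<in> carrier (FR G)" using FR_cost_closed[OF assms(2)] .
  {
    case FR_cost_one
    then show ?case using assms(2) y by simp
  next
    case (FR_cost_step h g x c r)
    then have "h \<otimes>\<^bsub>FR G\<^esub> FR_gen G g r \<otimes>\<^bsub>FR G\<^esub> inv\<^bsub>FR G\<^esub> h \<otimes>\<^bsub>FR G\<^esub> x \<otimes>\<^bsub>FR G\<^esub> y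
        = h \<otimes>\<^bsub>FR G\<^esub> FR_gen G g r \<otimes>\<^bsub>FR G\<^esub> inv\<^bsub>FR G\<^esub> h \<otimes>\<^bsub>FR G\<^esub> (x \<otimes>\<^bsub>FR G\<^esub> y)"
      using y FR_cost_closed[OF FR_cost_step(3)] by (simp add: F.m_assoc FR_gen_closed)
    then show ?case using FR_cost.FR_cost_step[OF FR_cost_step(1,2) FR_cost_step.IH, of r]
      by (simp add: add.assoc)
  }
qed

text \<open>
  To conjugate a product, conjugate each factor; to invert it, reverse the order of
  the factors and change the signs of the exponents. Neither changes the cost.
\<close>

lemma FR_cost_group_cost:
  assumes nonneg: "\<And>g. g \<in> carrier G \<Longrightarrow> 0 \<le> nrm g"
  shows "group_cost (FR G) (FR_cost G nrm)"
proof -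
  interpret F: group "FR G" by (rule FR_group)
  have conj: "FR_cost G nrm (y \<otimes>\<^bsub>FR G\<^esub> x \<otimes>\<^bsub>FR G\<^esub> inv\<^bsub>FR G\<^esub> y) c"
    if y: "y \<in> carrier (FR G)" and "FR_cost G nrm x c" for x y c
    using that(2)
  proof induction
    case FR_cost_one
    then show ?case using y by (simp add: FR_cost.FR_cost_one)
  next
    case (FR_cost_step h g x c r)
    have "y \<otimes>\<^bsub>FR G\<^esub> (h \<otimes>\<^bsub>FR G\<^esub> FR_gen G g r \<otimes>\<^bsub>FR G\<^esub> inv\<^bsub>FR G\<^esub> h \<otimes>\<^bsub>FR G\<^esub> x) \<otimes>\<^bsub>FR G\<^esub> inv\<^bsub>FR G\<^esub> y
        = (y \<otimes>\<^bsub>FR G\<^esub> h) \<otimes>\<^bsub>FR G\<^esub> FR_gen G g r \<otimes>\<^bsub>FR G\<^esub> inv\<^bsub>FR G\<^esub> (y \<otimes>\<^bsub>FR G\<^esub> h)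
            \<otimes>\<^bsub>FR G\<^esub> (y \<otimes>\<^bsub>FR G\<^esub> x \<otimes>\<^bsub>FR G\<^esub> inv\<^bsub>FR G\<^esub> y)"
      using y FR_cost_step(1,2) FR_cost_closed[OF FR_cost_step(3)]
      by (simp add: F.m_assoc F.inv_mult_group FR_gen_closed)
    then show ?case
      using FR_cost.FR_cost_step[OF _ FR_cost_step(2) FR_cost_step.IH, of "y \<otimes>\<^bsub>FR G\<^esub> h" r] y FR_cost_step(1)
      by simp
  qed
  show ?thesis
  proof unfold_locales
    fix x assume "x \<in> carrier (FR G)"
    then show "\<exists>c. FR_cost G nrm x c"
      by (induction rule: FR_induct) (blast intro: FR_cost_one FR_cost_mult FR_cost_gen)+
  next
    fix x c assume "FR_cost G nrm x c"
    then show "0 \<le> c" by induction (simp_all add: nonneg)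
  next
    show "FR_cost G nrm \<one>\<^bsub>FR G\<^esub> 0" by (rule FR_cost_one)
  next
    fix x c assume "FR_cost G nrm x c"
    then show "FR_cost G nrm (inv\<^bsub>FR G\<^esub> x) c"
    proof induction
      case FR_cost_one
      show ?case by (simp add: FR_cost.FR_cost_one)
    next
      case (FR_cost_step h g x c r)
      have "inv\<^bsub>FR G\<^esub> (h \<otimes>\<^bsub>FR G\<^esub> FR_gen G g r \<otimes>\<^bsub>FR G\<^esub> inv\<^bsub>FR G\<^esub> h \<otimes>\<^bsub>FR G\<^esub> x)
        = inv\<^bsub>FR G\<^esub> x \<otimes>\<^bsub>FR G\<^esub> (h \<otimes>\<^bsub>FR G\<^esub> FR_gen G g (- r) \<otimes>\<^bsub>FR G\<^esub> inv\<^bsub>FR G\<^esub> h)"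
        using FR_cost_step(1,2) FR_cost_closed[OF FR_cost_step(3)]
        by (simp add: F.m_assoc F.inv_mult_group FR_gen_closed inv_FR_gen)
      then show ?case
        using FR_cost_mult[OF FR_cost_step.IH FR_cost_conj_gen[OF FR_cost_step(1,2), of nrm "- r"]]
        by (simp add: add.commute)
    qed
  next
    fix x y c d assume "FR_cost G nrm x c" "FR_cost G nrm y d"
    then show "\<exists>e\<le>c + d. FR_cost G nrm (x \<otimes>\<^bsub>FR G\<^esub> y) e" using FR_cost_mult by blast
  next
    fix x y c assume "y \<in> carrier (FR G)" "FR_cost G nrm x c"
    then show "FR_cost G nrm (y \<otimes>\<^bsub>FR G\<^esub> x \<otimes>\<^bsub>FR G\<^esub> inv\<^bsub>FR G\<^esub> y) c" by (rule conj)
  qed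
qed

lemma FR_pseudonorm:
  assumes "\<And>g. g \<in> carrier G \<Longrightarrow> 0 \<le> nrm g"
  shows "conj_pseudonormed_group (FR G) (FR_norm G nrm)"
proof -
  have "FR_norm G nrm = (\<lambda>x. Inf {c. FR_cost G nrm x c})" by (intro ext FR_norm_eq_Inf_cost)
  then show ?thesis using group_cost.pseudonorm[OF FR_cost_group_cost[OF assms]] by simp
qed

lemma FR_norm_gen_le:
  assumes "\<And>g. g \<in> carrier G \<Longrightarrow> 0 \<le> nrm g" and "g \<in> carrier G"
  shows "FR_norm G nrm (FR_gen G g r) \<le> \<bar>r\<bar> * nrm g"
  unfolding FR_norm_eq_Inf_cost
  by (rule group_cost.Inf_cost_le[OF FR_cost_group_cost[OF assms(1)] FR_cost_gen[OF assms(2)]])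

subsection \<open>Functoriality\<close>

text \<open>
  Relabelling the letters along a map of sets \<open>\<phi>\<close> is a homomorphism of free products, whatever \<open>\<phi>\<close> is.
  Through it a set-theoretic section of \<open>\<pi>\<close> turns into a homomorphism \<open>F\<^sub>\<real>(H) \<rightarrow> F\<^sub>\<real>(G)\<close>.
\<close>

definition FR_map ::
  "('b, 'k) monoid_scheme \<Rightarrow> ('a \<Rightarrow> 'b) \<Rightarrow> ('a \<times> real) list set \<Rightarrow> ('b \<times> real) list set" where
  "FR_map H \<phi> A = fp_rel (carrier H) (\<lambda>_. real_group) `` (map (apfst \<phi>) ` A)"

lemma map_letters_closed:
  "\<phi> \<in> carrier G \<rightarrow> carrier H \<Longrightarrow> u \<in> lists (carrier G \<times> UNIV) \<Longrightarrow> 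
     map (apfst \<phi>) u \<in> lists (carrier H \<times> UNIV)"
  by (fastforce simp: Pi_iff)

lemma FR_map_class:
  assumes \<phi>: "\<phi> \<in> carrier G \<rightarrow> carrier H" and u: "u \<in> lists (carrier G \<times> UNIV)"
  shows "FR_map H \<phi> (fp_rel (carrier G) (\<lambda>_. real_group) `` {u})
       = fp_rel (carrier H) (\<lambda>_. real_group) `` {map (apfst \<phi>) u}"
proof -
  let ?G = "fp_rel (carrier G) (\<lambda>_. real_group)" and ?H = "fp_rel (carrier H) (\<lambda>_. real_group)"
  let ?f = "map (apfst \<phi>) :: ('a \<times> real) list \<Rightarrow> _"
  have f: "?f x \<in> fp_words (carrier H) (\<lambda>_. real_group)"
    if "x \<in> fp_words (carrier G) (\<lambda>_. real_group)" for x
    using map_letters_closed[OF \<phi>, of x] that by (simp only: FR_words)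
  have r: "(?f x, ?f y) \<in> ?H" if "(x, y) \<in> ?G" for x y
    using that
  proof (induction rule: fp_rel.induct)
    case (fp_one u v i)
    then have "\<phi> i \<in> carrier H" using \<phi> by blast
    then show ?case using fp_rel.fp_one[OF f[OF fp_one(1)] f[OF fp_one(2)]] by simp
  next
    case (fp_mult u v i a b)
    then have "\<phi> i \<in> carrier H" using \<phi> by blast
    then show ?case
      using fp_rel.fp_mult[OF f[OF fp_mult(1)] f[OF fp_mult(2)], of "\<phi> i" a b] fp_mult(4,5) by simp
  qed (auto intro: fp_rel.intros f)
  have "(u, u) \<in> ?G" using u by (intro fp_refl) (simp only: FR_words)
  then show ?thesis unfolding FR_map_def using r by (blast intro: fp_trans)
qed

lemma FR_map_hom:
  assumes \<phi>: "\<phi> \<in> carrier G \<rightarrow> carrier H"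
  shows "FR_map H \<phi> \<in> hom (FR G) (FR H)"
proof (rule homI)
  fix A assume "A \<in> carrier (FR G)"
  then obtain u where u: "u \<in> lists (carrier G \<times> UNIV)" "A = fp_rel (carrier G) (\<lambda>_. real_group) `` {u}"
    by (auto simp: carrier_FR_iff)
  then show "FR_map H \<phi> A \<in> carrier (FR H)"
    using map_letters_closed[OF \<phi> u(1)] unfolding carrier_FR_iff u(2) FR_map_class[OF \<phi> u(1)] by blast
  fix B assume "B \<in> carrier (FR G)"
  then obtain v where v: "v \<in> lists (carrier G \<times> UNIV)" "B = fp_rel (carrier G) (\<lambda>_. real_group) `` {v}"
    by (auto simp: carrier_FR_iff)
  have uv: "u @ v \<in> lists (carrier G \<times> UNIV)" using u v by simp
  show "FR_map H \<phi> (A \<otimes>\<^bsub>FR G\<^esub> B) = FR_map H \<phi> A \<otimes>\<^bsub>FR H\<^esub> FR_map H \<phi> B"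
    unfolding u(2) v(2) FR_mult[OF u(1) v(1)] FR_map_class[OF \<phi> u(1)] FR_map_class[OF \<phi> v(1)]
      FR_map_class[OF \<phi> uv] FR_mult[OF map_letters_closed[OF \<phi> u(1)] map_letters_closed[OF \<phi> v(1)]]
    by simp
qed

lemma FR_map_group_hom: "\<phi> \<in> carrier G \<rightarrow> carrier H \<Longrightarrow> group_hom (FR G) (FR H) (FR_map H \<phi>)"
  by (simp add: group_hom_def group_hom_axioms_def FR_group FR_map_hom)

lemma FR_map_gen:
  "\<phi> \<in> carrier G \<rightarrow> carrier H \<Longrightarrow> g \<in> carrier G \<Longrightarrow> FR_map H \<phi> (FR_gen G g r) = FR_gen H (\<phi> g) r"
  using FR_map_class[of \<phi> G H "[(g, r)]"] by (simp add: FR_gen_def)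

lemma FR_map_psi:
  assumes \<phi>: "\<phi> \<in> carrier G \<rightarrow> carrier H" and "A \<in> carrier (FR G)"
  shows "FR_map H \<phi> (psi G t A) = psi H t (FR_map H \<phi> A)"
proof -
  interpret f: group_hom "FR G" "FR H" "FR_map H \<phi>" by (rule FR_map_group_hom[OF \<phi>])
  interpret p: group_hom "FR G" "FR G" "psi G t"
    by (simp add: group_hom_def group_hom_axioms_def FR_group psi_hom)
  interpret q: group_hom "FR H" "FR H" "psi H t"
    by (simp add: group_hom_def group_hom_axioms_def FR_group psi_hom)
  show ?thesis
    using assms(2)
  proof (induction rule: FR_induct)
    case one
    then show ?case by simp
  next
    case (gen g r x)
    moreover have "\<phi> g \<in> carrier H" using gen \<phi> by blast
    ultimately show ?case by (simp add: FR_gen_closed psi_FR_gen FR_map_gen[OF \<phi>])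
  qed
qed

lemma FR_map_section:
  assumes \<sigma>: "\<sigma> \<in> carrier H \<rightarrow> carrier G" and \<phi>: "\<phi> \<in> carrier G \<rightarrow> carrier H"
    and sec: "\<And>h. h \<in> carrier H \<Longrightarrow> \<phi> (\<sigma> h) = h" and "A \<in> carrier (FR H)"
  shows "FR_map H \<phi> (FR_map G \<sigma> A) = A"
proof -
  interpret f: group_hom "FR G" "FR H" "FR_map H \<phi>" by (rule FR_map_group_hom[OF \<phi>])
  interpret s: group_hom "FR H" "FR G" "FR_map G \<sigma>" by (rule FR_map_group_hom[OF \<sigma>])
  show ?thesis
    using assms(4)
  proof (induction rule: FR_induct)
    case one
    then show ?case by simp
  next
    case (gen g r x)
    moreover have "\<sigma> g \<in> carrier G" using gen \<sigma> by blast
    ultimately show ?case by (simp add: FR_gen_closed FR_map_gen[OF \<phi>] FR_map_gen[OF \<sigma>] sec)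
  qed
qed

text \<open>
  Relabelling a product of conjugates gives a product of conjugates whose cost has grown at most
  by the factor \<open>C\<close>.
\<close>

lemma FR_map_norm_le:
  assumes \<phi>: "\<phi> \<in> carrier G \<rightarrow> carrier H" and C: "0 \<le> C"
    and nG: "\<And>g. g \<in> carrier G \<Longrightarrow> 0 \<le> nG g" and nH: "\<And>h. h \<in> carrier H \<Longrightarrow> 0 \<le> nH h"
    and le: "\<And>g. g \<in> carrier G \<Longrightarrow> nH (\<phi> g) \<le> C * nG g"
    and x: "x \<in> carrier (FR G)"
  shows "FR_norm H nH (FR_map H \<phi> x) \<le> C * FR_norm G nG x"
proof -
  interpret f: group_hom "FR G" "FR H" "FR_map H \<phi>" by (rule FR_map_group_hom[OF \<phi>])
  interpret G: group_cost "FR G" "FR_cost G nG" by (rule FR_cost_group_cost[OF nG])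
  interpret H: group_cost "FR H" "FR_cost H nH" by (rule FR_cost_group_cost[OF nH])
  have "\<exists>d\<le>C * c. FR_cost H nH (FR_map H \<phi> y) d" if "FR_cost G nG y c" for y c
    using that
  proof induction
    case FR_cost_one
    then show ?case using FR_cost.FR_cost_one[of H nH] by auto
  next
    case (FR_cost_step h g y c r)
    then obtain d where d: "d \<le> C * c" "FR_cost H nH (FR_map H \<phi> y) d" by blast
    have g: "\<phi> g \<in> carrier H" using \<phi> FR_cost_step(2) by blast
    have "FR_map H \<phi> (h \<otimes>\<^bsub>FR G\<^esub> FR_gen G g r \<otimes>\<^bsub>FR G\<^esub> inv\<^bsub>FR G\<^esub> h \<otimes>\<^bsub>FR G\<^esub> y) =
       FR_map H \<phi> h \<otimes>\<^bsub>FR H\<^esub> FR_gen H (\<phi> g) r \<otimes>\<^bsub>FR H\<^esub> inv\<^bsub>FR H\<^esub> (FR_map H \<phi> h) \<otimes>\<^bsub>FR H\<^esub> FR_map H \<phi> y"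
      using FR_cost_step(1,2) FR_cost_closed[OF FR_cost_step(3)]
      by (simp add: FR_map_gen[OF \<phi>] FR_gen_closed)
    moreover have "\<bar>r\<bar> * nH (\<phi> g) + d \<le> C * (\<bar>r\<bar> * nG g + c)"
      using mult_left_mono[OF le[OF FR_cost_step(2)], of "\<bar>r\<bar>"] d(1) by (simp add: algebra_simps)
    ultimately show ?case
      using FR_cost.FR_cost_step[OF f.hom_closed[OF FR_cost_step(1)] g d(2), of r] by auto
  qed
  then have "Inf {c. FR_cost H nH (FR_map H \<phi> x) c} \<le> C * c" if "FR_cost G nG x c" for c
    using that H.Inf_cost_le by fastforce
  then show ?thesis unfolding FR_norm_eq_Inf_cost by (rule G.Inf_cost_mono[OF x C])
qed

subsection \<open>The free subgroup\<close>

lemma carrier_FZ: "carrier (FZ G) = generate (FR G) ((\<lambda>g. FR_gen G g 1) ` carrier G)"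
proof -
  have "carrier (FR G) \<inter> (\<lambda>g. FR_gen G g 1) ` carrier G = (\<lambda>g. FR_gen G g 1) ` carrier G"
    using FR_gen_closed[of _ G 1] by blast
  then show ?thesis by (simp add: FZ_def carrier_subgroup_generated)
qed

lemma FZ_group: "group (FZ G)"
  unfolding FZ_def by (rule group.group_subgroup_generated[OF FR_group])

lemma FZ_mult: "x \<otimes>\<^bsub>FZ G\<^esub> y = x \<otimes>\<^bsub>FR G\<^esub> y"
  by (simp add: FZ_def)

lemma FZ_one: "\<one>\<^bsub>FZ G\<^esub> = \<one>\<^bsub>FR G\<^esub>"
  by (simp add: FZ_def)

lemma FZ_inv: "x \<in> carrier (FZ G) \<Longrightarrow> inv\<^bsub>FZ G\<^esub> x = inv\<^bsub>FR G\<^esub> x"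
  unfolding FZ_def by (rule group.inv_subgroup_generated[OF FR_group])

lemma FZ_subset_FR: "x \<in> carrier (FZ G) \<Longrightarrow> x \<in> carrier (FR G)"
  unfolding FZ_def using group.carrier_subgroup_generated_subset[OF FR_group] by blast

lemma FZ_gen: "g \<in> carrier G \<Longrightarrow> FR_gen G g 1 \<in> carrier (FZ G)"
  unfolding carrier_FZ by (intro generate.incl imageI)

lemma FZ_induct [consumes 1, case_names one gen inv mult]:
  assumes "A \<in> carrier (FZ G)"
    and one: "P \<one>\<^bsub>FZ G\<^esub>"
    and gen: "\<And>g. g \<in> carrier G \<Longrightarrow> P (FR_gen G g 1)"
    and inv: "\<And>g. g \<in> carrier G \<Longrightarrow> P (inv\<^bsub>FZ G\<^esub> (FR_gen G g 1))"
    and mult: "\<And>x y. x \<in> carrier (FZ G) \<Longrightarrow> y \<in> carrier (FZ G) \<Longrightarrow> P x \<Longrightarrow> P y \<Longrightarrow> P (x \<otimes>\<^bsub>FZ G\<^esub> y)"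
  shows "P A"
  using assms(1) unfolding carrier_FZ
proof (induction rule: generate.induct)
  case one
  then show ?case using assms(2) by (simp add: FZ_one)
next
  case (incl h)
  then show ?case using gen by blast
next
  case (inv h)
  then show ?case using assms(4) FZ_inv FZ_gen by fastforce
next
  case (eng x y)
  then show ?case using mult[of x y] by (simp add: FZ_mult carrier_FZ)
qed

lemma FR_map_FZ:
  assumes \<phi>: "\<phi> \<in> carrier G \<rightarrow> carrier H" and "x \<in> carrier (FZ G)"
  shows "FR_map H \<phi> x \<in> carrier (FZ H)"
proof -
  interpret f: group_hom "FR G" "FR H" "FR_map H \<phi>" by (rule FR_map_group_hom[OF \<phi>])
  interpret Z: group "FZ H" by (rule FZ_group)
  have gen: "FR_map H \<phi> (FR_gen G g 1) \<in> carrier (FZ H)" if "g \<in> carrier G" for g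
    using that \<phi> by (auto simp: FR_map_gen[OF \<phi>] intro!: FZ_gen)
  show ?thesis
    using assms(2)
  proof (induction rule: FZ_induct)
    case one
    then show ?case using Z.one_closed by (simp add: FZ_one)
  next
    case (gen g)
    then show ?case by (rule \<open>\<And>g. g \<in> carrier G \<Longrightarrow> FR_map H \<phi> (FR_gen G g 1) \<in> carrier (FZ H)\<close>)
  next
    case (inv g)
    then show ?case using Z.inv_closed[OF gen[OF inv]]
      by (simp add: FZ_inv[OF gen[OF inv]] FZ_inv[OF FZ_gen[OF inv]] FR_gen_closed)
  next
    case (mult x y)
    then show ?case using Z.m_closed[OF mult(3,4)] by (simp add: FZ_mult FZ_subset_FR)
  qed
qed

lemma piG_group_hom: "group G \<Longrightarrow> group_hom (FZ G) G (piG G)"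
  by (simp add: group_hom_def group_hom_axioms_def FZ_group group.piG_hom)

text \<open>
  In contrast to the other properties of \<open>FR_map\<close>, compatibility with the evaluations \<open>\<pi>\<^sub>G\<close> and
  \<open>\<pi>\<^sub>H\<close> requires a homomorphism: both sides are then homomorphisms which agree on the generators.
\<close>

lemma piG_natural:
  assumes "group G" "group H" and hom: "\<phi> \<in> hom G H" and "x \<in> carrier (FZ G)"
  shows "piG H (FR_map H \<phi> x) = \<phi> (piG G x)"
proof -
  have \<phi>: "\<phi> \<in> carrier G \<rightarrow> carrier H" using hom by (simp add: hom_def)
  interpret f: group_hom "FR G" "FR H" "FR_map H \<phi>" by (rule FR_map_group_hom[OF \<phi>])
  interpret p: group_hom "FZ G" G "piG G" by (rule piG_group_hom[OF assms(1)])
  interpret q: group_hom "FZ H" H "piG H" by (rule piG_group_hom[OF assms(2)])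
  interpret h: group_hom G H \<phi> using assms by (simp add: group_hom_def group_hom_axioms_def)
  have gen: "piG H (FR_map H \<phi> (FR_gen G g 1)) = \<phi> (piG G (FR_gen G g 1))" if "g \<in> carrier G" for g
    using that by (simp add: FR_map_gen[OF \<phi>] group.piG_gen[OF assms(1)] group.piG_gen[OF assms(2)])
  show ?thesis
    using assms(4)
  proof (induction rule: FZ_induct)
    case one
    have "FR_map H \<phi> \<one>\<^bsub>FZ G\<^esub> = \<one>\<^bsub>FZ H\<^esub>" by (simp add: FZ_one)
    then show ?case by (simp only: q.hom_one p.hom_one h.hom_one)
  next
    case (gen g)
    then show ?case by (rule \<open>\<And>g. g \<in> carrier G \<Longrightarrow> piG H (FR_map H \<phi> (FR_gen G g 1)) = \<phi> (piG G (FR_gen G g 1))\<close>)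
  next
    case (inv g)
    note Z = FR_map_FZ[OF \<phi> FZ_gen[OF inv]]
    have "FR_map H \<phi> (inv\<^bsub>FZ G\<^esub> FR_gen G g 1) = inv\<^bsub>FZ H\<^esub> (FR_map H \<phi> (FR_gen G g 1))"
      using inv by (simp add: FZ_inv[OF Z] FZ_inv[OF FZ_gen[OF inv]] FR_gen_closed)
    then show ?case using q.hom_inv[OF Z] p.hom_inv[OF FZ_gen[OF inv]] gen[OF inv] FZ_gen[OF inv] by simp
  next
    case (mult x y)
    have "FR_map H \<phi> (x \<otimes>\<^bsub>FZ G\<^esub> y) = FR_map H \<phi> x \<otimes>\<^bsub>FZ H\<^esub> FR_map H \<phi> y"
      using mult(1,2) by (simp add: FZ_mult FZ_subset_FR)
    then show ?case using mult FR_map_FZ[OF \<phi> mult(1)] FR_map_FZ[OF \<phi> mult(2)] by simp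
  qed
qed

section \<open>Limits along a scaling set\<close>

definition scaling_set :: "real set \<Rightarrow> bool" where
  "scaling_set T \<longleftrightarrow> T \<subseteq> {0<..} \<and> (\<forall>x. \<exists>t\<in>T. x \<le> t)"

lemma scaling_set_pos: "scaling_set {0<..}"
  unfolding scaling_set_def
proof (intro conjI allI)
  fix x :: real
  show "\<exists>t\<in>{0<..}. x \<le> t" by (rule bexI[of _ "max x 1"]) auto
qed simp

abbreviation along :: "real set \<Rightarrow> real filter" where
  "along T \<equiv> inf at_top (principal T)"

lemma eventually_along: "eventually P (along T) \<longleftrightarrow> (\<exists>t\<^sub>0. \<forall>t\<in>T. t\<^sub>0 \<le> t \<longrightarrow> P t)"
  unfolding eventually_inf_principal eventually_at_top_linorder by blast

lemma along_not_bot: "scaling_set T \<Longrightarrow> along T \<noteq> bot"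
  unfolding trivial_limit_def eventually_along scaling_set_def by blast

lemma eventually_along_mem: "(\<And>t. t \<in> T \<Longrightarrow> P t) \<Longrightarrow> eventually P (along T)"
  by (auto simp: eventually_along)

lemma cauchy_along_cong:
  "(\<And>t. t \<in> T \<Longrightarrow> f t = g t) \<Longrightarrow> cauchy_along K n T f \<longleftrightarrow> cauchy_along K n T g"
  by (simp add: cauchy_along_def)

lemma cauchy_alongE:
  assumes "cauchy_along K n T f" "0 < \<epsilon>"
  obtains t\<^sub>0 where "\<And>t t'. t \<in> T \<Longrightarrow> t' \<in> T \<Longrightarrow> t\<^sub>0 \<le> t \<Longrightarrow> t\<^sub>0 \<le> t' \<Longrightarrow> nrm_dist K n (f t) (f t') < \<epsilon>"
  using assms unfolding cauchy_along_def by blast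

context conj_pseudonormed_group
begin

lemma cauchy_along_mult:
  assumes f: "cauchy_along K n T f" "\<And>t. t \<in> T \<Longrightarrow> f t \<in> carrier K"
    and g: "cauchy_along K n T g" "\<And>t. t \<in> T \<Longrightarrow> g t \<in> carrier K"
  shows "cauchy_along K n T (\<lambda>t. f t \<otimes> g t)"
  unfolding cauchy_along_def
proof (intro allI impI)
  fix \<epsilon> :: real assume "0 < \<epsilon>"
  then have e: "0 < \<epsilon> / 2" by simp
  obtain a where a: "\<And>t t'. t \<in> T \<Longrightarrow> t' \<in> T \<Longrightarrow> a \<le> t \<Longrightarrow> a \<le> t' \<Longrightarrow> nrm_dist K n (f t) (f t') < \<epsilon> / 2"
    using cauchy_alongE[OF f(1) e] by blast
  obtain b where b: "\<And>t t'. t \<in> T \<Longrightarrow> t' \<in> T \<Longrightarrow> b \<le> t \<Longrightarrow> b \<le> t' \<Longrightarrow> nrm_dist K n (g t) (g t') < \<epsilon> / 2"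
    using cauchy_alongE[OF g(1) e] by blast
  have "nrm_dist K n (f t \<otimes> g t) (f t' \<otimes> g t') < \<epsilon>"
    if t: "t \<in> T" "t' \<in> T" "max a b \<le> t" "max a b \<le> t'" for t t'
    using dist_mult[OF f(2)[OF t(1)] f(2)[OF t(2)] g(2)[OF t(1)] g(2)[OF t(2)]] a[of t t'] b[of t t'] t
    by simp
  then show "\<exists>t\<^sub>0. \<forall>t\<in>T. \<forall>t'\<in>T. t\<^sub>0 \<le> t \<longrightarrow> t\<^sub>0 \<le> t' \<longrightarrow> nrm_dist K n (f t \<otimes> g t) (f t' \<otimes> g t') < \<epsilon>"
    by blast
qed

lemma cauchy_along_inv:
  assumes "cauchy_along K n T f" "\<And>t. t \<in> T \<Longrightarrow> f t \<in> carrier K"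
  shows "cauchy_along K n T (\<lambda>t. inv f t)"
  using assms(1) unfolding cauchy_along_def by (simp only: dist_inv assms(2) cong: ball_cong)

text \<open>
  Functions of vanishing norm at infinity are Cauchy; this covers the constant function \<open>1\<close> and the
  lifts of bounded functions.
\<close>

lemma cauchy_along_null:
  assumes lim: "((\<lambda>t. n (f t)) \<longlongrightarrow> 0) (along T)" and f: "\<And>t. t \<in> T \<Longrightarrow> f t \<in> carrier K"
  shows "cauchy_along K n T f"
  unfolding cauchy_along_def
proof (intro allI impI)
  fix \<epsilon> :: real assume "0 < \<epsilon>"
  then have "eventually (\<lambda>t. n (f t) < \<epsilon> / 2) (along T)" by (intro order_tendstoD(2)[OF lim]) simp
  then obtain a where a: "\<And>t. t \<in> T \<Longrightarrow> a \<le> t \<Longrightarrow> n (f t) < \<epsilon> / 2"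
    unfolding eventually_along by blast
  have "nrm_dist K n (f t) (f t') < \<epsilon>" if "t \<in> T" "t' \<in> T" "a \<le> t" "a \<le> t'" for t t'
    using dist_le_sum[OF f f, of t t'] a[of t] a[of t'] that by simp
  then show "\<exists>t\<^sub>0. \<forall>t\<in>T. \<forall>t'\<in>T. t\<^sub>0 \<le> t \<longrightarrow> t\<^sub>0 \<le> t' \<longrightarrow> nrm_dist K n (f t) (f t') < \<epsilon>" by blast
qed

text \<open>
  The norm is \<open>1\<close>-Lipschitz, so it converges along every sequence in \<open>T\<close> tending to infinity, and
  the Cauchy condition carries the limit over from one such sequence to all of \<open>T\<close>. This makes the
  limit in the pseudonorm of \<open>\<D>(G,T)\<close> meaningful.
\<close>

lemma cauchy_along_norm_tendsto:
  assumes T: "scaling_set T"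
    and f: "cauchy_along K n T f" "\<And>t. t \<in> T \<Longrightarrow> f t \<in> carrier K"
  shows "((\<lambda>t. n (f t)) \<longlongrightarrow> Lim (along T) (\<lambda>t. n (f t))) (along T)"
proof -
  have "\<forall>k. \<exists>t. t \<in> T \<and> real k \<le> t" using T by (auto simp: scaling_set_def)
  then obtain s where s: "\<And>k. s k \<in> T" "\<And>k. real k \<le> s k" by metis
  have diff: "\<bar>n (f t) - n (f t')\<bar> \<le> nrm_dist K n (f t) (f t')" if "t \<in> T" "t' \<in> T" for t t'
    using that by (intro norm_diff_le_dist f(2))
  have "Cauchy (\<lambda>k. n (f (s k)))"
  proof (rule metric_CauchyI)
    fix \<epsilon> :: real assume "0 < \<epsilon>"
    then obtain a where a: "\<And>t t'. t \<in> T \<Longrightarrow> t' \<in> T \<Longrightarrow> a \<le> t \<Longrightarrow> a \<le> t' \<Longrightarrow> nrm_dist K n (f t) (f t') < \<epsilon>"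
      using cauchy_alongE[OF f(1)] by blast
    have "dist (n (f (s i))) (n (f (s j))) < \<epsilon>" if "nat \<lceil>a\<rceil> \<le> i" "nat \<lceil>a\<rceil> \<le> j" for i j
    proof -
      have "a \<le> s i" "a \<le> s j" using that s(2)[of i] s(2)[of j] by linarith+
      then show ?thesis using a[OF s(1) s(1), of i j] diff[OF s(1) s(1), of i j]
        by (simp add: dist_real_def)
    qed
    then show "\<exists>M. \<forall>i\<ge>M. \<forall>j\<ge>M. dist (n (f (s i))) (n (f (s j))) < \<epsilon>" by blast
  qed
  then obtain L where L: "(\<lambda>k. n (f (s k))) \<longlonglongrightarrow> L" using Cauchy_convergent convergentD by blast
  have "((\<lambda>t. n (f t)) \<longlongrightarrow> L) (along T)"
  proof (rule tendstoI)
    fix \<epsilon> :: real assume "0 < \<epsilon>"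
    then have e: "0 < \<epsilon> / 2" by simp
    obtain a where a: "\<And>t t'. t \<in> T \<Longrightarrow> t' \<in> T \<Longrightarrow> a \<le> t \<Longrightarrow> a \<le> t' \<Longrightarrow> nrm_dist K n (f t) (f t') < \<epsilon> / 2"
      using cauchy_alongE[OF f(1) e] by blast
    obtain M where M: "\<And>k. M \<le> k \<Longrightarrow> dist (n (f (s k))) L < \<epsilon> / 2"
      using metric_LIMSEQ_D[OF L e] by blast
    define k where "k = max M (nat \<lceil>a\<rceil>)"
    have k: "a \<le> s k" "dist (n (f (s k))) L < \<epsilon> / 2"
      using s(2)[of k] M[of k] by (auto simp: k_def) linarith
    have "dist (n (f t)) L < \<epsilon>" if "t \<in> T" "a \<le> t" for t
      using diff[OF that(1) s(1), of k] a[OF that(1) s(1) that(2) k(1)] k(2)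
      unfolding dist_real_def by linarith
    then show "eventually (\<lambda>t. dist (n (f t)) L < \<epsilon>) (along T)" unfolding eventually_along by blast
  qed
  then show ?thesis using tendsto_Lim[OF along_not_bot[OF T]] by metis
qed

end

section \<open>The directional asymptotic cone\<close>

locale directional_cone = conj_normed_group G nrm
  for G :: "('a, 'm) monoid_scheme" (structure) and nrm :: "'a \<Rightarrow> real" +
  fixes T :: "real set"
  assumes scaling: "scaling_set T"
begin

sublocale FR: conj_pseudonormed_group "FR G" "FR_norm G nrm"
  by (rule FR_pseudonorm) (rule nrm_nonneg)

sublocale FZ: group "FZ G"
  by (rule FZ_group)

sublocale piG: group_hom "FZ G" G "piG G"
  by (rule piG_group_hom) (rule is_group)

sublocale psi: group_hom "FR G" "FR G" "psi G t" for t
  by (simp add: group_hom_def group_hom_axioms_def FR_group psi_hom)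

lemma psi_closed: "x \<in> carrier (FZ G) \<Longrightarrow> psi G t x \<in> carrier (FR G)"
  by (rule psi.hom_closed) (rule FZ_subset_FR)

lemma psi_mult: "x \<in> carrier (FZ G) \<Longrightarrow> y \<in> carrier (FZ G) \<Longrightarrow>
    psi G t (x \<otimes>\<^bsub>FZ G\<^esub> y) = psi G t x \<otimes>\<^bsub>FR G\<^esub> psi G t y"
  unfolding FZ_mult by (intro psi.hom_mult FZ_subset_FR)

lemma psi_inv: "x \<in> carrier (FZ G) \<Longrightarrow> psi G t (inv\<^bsub>FZ G\<^esub> x) = inv\<^bsub>FR G\<^esub> (psi G t x)"
  by (simp only: FZ_inv psi.hom_inv FZ_subset_FR)

abbreviation D where "D \<equiv> Dgroup G nrm T"
abbreviation C where "C \<equiv> Cgroup G nrm T"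
abbreviation rescaled where "rescaled w t \<equiv> psi G (1 / t) (w t)"
abbreviation lim_norm where "lim_norm \<equiv> Dnorm G nrm T"
abbreviation proj where "proj w \<equiv> restrict (piG G \<circ> w) T"

lemma carrier_D: "w \<in> carrier D \<longleftrightarrow>
    w \<in> T \<rightarrow>\<^sub>E carrier (FZ G) \<and> cauchy_along (FR G) (FR_norm G nrm) T (rescaled w)"
  by (simp add: Dgroup_def)

lemma D_FZ: "w \<in> carrier D \<Longrightarrow> t \<in> T \<Longrightarrow> w t \<in> carrier (FZ G)"
  by (auto simp: carrier_D)

lemma D_mult: "v \<otimes>\<^bsub>D\<^esub> w = (\<lambda>t\<in>T. v t \<otimes>\<^bsub>FZ G\<^esub> w t)"
  by (simp add: Dgroup_def)

lemma D_one: "\<one>\<^bsub>D\<^esub> = (\<lambda>t\<in>T. \<one>\<^bsub>FZ G\<^esub>)"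
  by (simp add: Dgroup_def)

lemma rescaled_one: "t \<in> T \<Longrightarrow> rescaled \<one>\<^bsub>D\<^esub> t = \<one>\<^bsub>FR G\<^esub>"
  by (simp add: D_one FZ_one)

lemma rescaled_mult:
  "v \<in> carrier D \<Longrightarrow> w \<in> carrier D \<Longrightarrow> t \<in> T \<Longrightarrow>
     rescaled (v \<otimes>\<^bsub>D\<^esub> w) t = rescaled v t \<otimes>\<^bsub>FR G\<^esub> rescaled w t"
  by (simp add: D_mult psi_mult D_FZ)

lemma rescaled_closed: "w \<in> carrier D \<Longrightarrow> t \<in> T \<Longrightarrow> rescaled w t \<in> carrier (FR G)"
  by (intro psi_closed D_FZ)

text \<open>
  The rescaling maps \<open>\<psi>\<^sub>1\<^sub>/\<^sub>t\<close> are homomorphisms, so pointwise products and inverses in \<open>F(G)\<close> become pointwise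
  products and inverses in \<open>F\<^sub>\<real>(G)\<close>, where Cauchy functions form a group by invariance of the metric.
\<close>

lemma D_subgroup: "subgroup (carrier D) (product_group T (\<lambda>_. FZ G))"
proof -
  interpret P: group "product_group T (\<lambda>_. FZ G)" by (rule product_group) (rule FZ_group)
  have "cauchy_along (FR G) (FR_norm G nrm) T (\<lambda>t. \<one>\<^bsub>FR G\<^esub>)"
    by (rule FR.cauchy_along_null) (simp_all add: FR.pn_one)
  then have "cauchy_along (FR G) (FR_norm G nrm) T (rescaled \<one>\<^bsub>D\<^esub>)"
    by (rule cauchy_along_cong[THEN iffD2, rotated]) (rule rescaled_one)
  then have one: "\<one>\<^bsub>D\<^esub> \<in> carrier D"
    unfolding carrier_D by (simp add: D_one)
  have mult: "v \<otimes>\<^bsub>D\<^esub> w \<in> carrier D" if vw: "v \<in> carrier D" "w \<in> carrier D" for v w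
  proof -
    have "cauchy_along (FR G) (FR_norm G nrm) T (\<lambda>t. rescaled v t \<otimes>\<^bsub>FR G\<^esub> rescaled w t)"
      using vw by (intro FR.cauchy_along_mult rescaled_closed) (simp_all only: carrier_D)
    then have "cauchy_along (FR G) (FR_norm G nrm) T (rescaled (v \<otimes>\<^bsub>D\<^esub> w))"
      by (rule cauchy_along_cong[THEN iffD2, rotated]) (rule rescaled_mult[OF vw])
    then show ?thesis unfolding carrier_D using D_FZ[OF vw(1)] D_FZ[OF vw(2)] by (simp add: D_mult)
  qed
  have inv: "(\<lambda>t\<in>T. inv\<^bsub>FZ G\<^esub> w t) \<in> carrier D" if w: "w \<in> carrier D" for w
  proof -
    have "cauchy_along (FR G) (FR_norm G nrm) T (\<lambda>t. inv\<^bsub>FR G\<^esub> rescaled w t)"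
      using w by (intro FR.cauchy_along_inv rescaled_closed) (simp_all only: carrier_D)
    then have "cauchy_along (FR G) (FR_norm G nrm) T (rescaled (\<lambda>t\<in>T. inv\<^bsub>FZ G\<^esub> w t))"
      by (rule cauchy_along_cong[THEN iffD2, rotated]) (simp add: psi_inv D_FZ[OF w])
    then show ?thesis unfolding carrier_D using D_FZ[OF w] by simp
  qed
  show ?thesis
  proof (rule P.subgroupI)
    show "carrier D \<subseteq> carrier (product_group T (\<lambda>_. FZ G))"
      by (rule subsetI) (simp add: carrier_D)
    show "carrier D \<noteq> {}" using one by blast
    show "inv\<^bsub>product_group T (\<lambda>_. FZ G)\<^esub> w \<in> carrier D" if "w \<in> carrier D" for w
      using inv[OF that] that by (simp add: carrier_D inv_product_group FZ_group)
    show "v \<otimes>\<^bsub>product_group T (\<lambda>_. FZ G)\<^esub> w \<in> carrier D" if "v \<in> carrier D" "w \<in> carrier D" for v w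
      using mult[OF that] by (simp add: D_mult)
  qed
qed

sublocale D: group D
proof -
  have "D = (product_group T (\<lambda>_. FZ G))\<lparr>carrier := carrier D\<rparr>" by (simp add: Dgroup_def)
  then show "group D"
    using subgroup.subgroup_is_group[OF D_subgroup product_group] FZ_group by metis
qed

lemma D_inv:
  assumes w: "w \<in> carrier D"
  shows "inv\<^bsub>D\<^esub> w = (\<lambda>t\<in>T. inv\<^bsub>FZ G\<^esub> w t)"
proof (rule D.inv_equality)
  have "inv\<^bsub>product_group T (\<lambda>_. FZ G)\<^esub> w = (\<lambda>t\<in>T. inv\<^bsub>FZ G\<^esub> w t)"
    using w by (intro inv_product_group FZ_group) (simp add: carrier_D)
  then show "(\<lambda>t\<in>T. inv\<^bsub>FZ G\<^esub> w t) \<in> carrier D"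
    using subgroup.m_inv_closed[OF D_subgroup w] by simp
  show "(\<lambda>t\<in>T. inv\<^bsub>FZ G\<^esub> w t) \<otimes>\<^bsub>D\<^esub> w = \<one>\<^bsub>D\<^esub>"
    by (auto simp: D_mult D_one D_FZ[OF w] cong: restrict_cong)
qed (rule w)

lemma rescaled_inv: "w \<in> carrier D \<Longrightarrow> t \<in> T \<Longrightarrow> rescaled (inv\<^bsub>D\<^esub> w) t = inv\<^bsub>FR G\<^esub> (rescaled w t)"
  by (simp add: D_inv psi_inv D_FZ)

lemma lim_norm_tendsto:
  "w \<in> carrier D \<Longrightarrow> ((\<lambda>t. FR_norm G nrm (rescaled w t)) \<longlongrightarrow> lim_norm w) (along T)"
  unfolding Dnorm_def
  by (rule FR.cauchy_along_norm_tendsto[OF scaling]) (simp_all only: carrier_D[THEN iffD1, THEN conjunct2] rescaled_closed)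

lemma lim_norm_eqI:
  "((\<lambda>t. FR_norm G nrm (rescaled w t)) \<longlongrightarrow> L) (along T) \<Longrightarrow> lim_norm w = L"
  unfolding Dnorm_def by (rule tendsto_Lim[OF along_not_bot[OF scaling]])

sublocale D: conj_pseudonormed_group D lim_norm
proof
  show "lim_norm \<one>\<^bsub>D\<^esub> = 0"
    by (intro lim_norm_eqI tendsto_eventually eventually_along_mem) (simp only: rescaled_one FR.pn_one)
next
  fix w assume w: "w \<in> carrier D"
  have "eventually (\<lambda>t. FR_norm G nrm (rescaled w t) = FR_norm G nrm (rescaled (inv\<^bsub>D\<^esub> w) t)) (along T)"
    using w by (intro eventually_along_mem) (simp only: rescaled_inv FR.pn_inv rescaled_closed)
  then show "lim_norm (inv\<^bsub>D\<^esub> w) = lim_norm w"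
    using lim_norm_tendsto[OF w] by (intro lim_norm_eqI) (simp only: tendsto_cong)
next
  fix v w assume v: "v \<in> carrier D" and w: "w \<in> carrier D"
  have "FR_norm G nrm (rescaled (v \<otimes>\<^bsub>D\<^esub> w) t) \<le> FR_norm G nrm (rescaled v t) + FR_norm G nrm (rescaled w t)"
    if "t \<in> T" for t
    using that v w by (simp only: rescaled_mult) (intro FR.pn_mult rescaled_closed)
  then show "lim_norm (v \<otimes>\<^bsub>D\<^esub> w) \<le> lim_norm v + lim_norm w"
    by (intro tendsto_le[OF along_not_bot[OF scaling] tendsto_add[OF lim_norm_tendsto[OF v] lim_norm_tendsto[OF w]]
          lim_norm_tendsto[OF D.m_closed[OF v w]]] eventually_along_mem)
  have "eventually (\<lambda>t. FR_norm G nrm (rescaled v t)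
      = FR_norm G nrm (rescaled (w \<otimes>\<^bsub>D\<^esub> v \<otimes>\<^bsub>D\<^esub> inv\<^bsub>D\<^esub> w) t)) (along T)"
    using v w by (intro eventually_along_mem)
      (simp only: rescaled_mult rescaled_inv rescaled_closed FR.pn_conj D.m_closed D.inv_closed)
  then show "lim_norm (w \<otimes>\<^bsub>D\<^esub> v \<otimes>\<^bsub>D\<^esub> inv\<^bsub>D\<^esub> w) = lim_norm v"
    using lim_norm_tendsto[OF v] by (intro lim_norm_eqI) (simp only: tendsto_cong)
qed

lemma carrier_C: "carrier C = proj ` carrier D"
  by (simp add: Cgroup_def)

lemma C_mult: "g \<otimes>\<^bsub>C\<^esub> h = (\<lambda>t\<in>T. g t \<otimes> h t)"
  by (simp add: Cgroup_def)

lemma proj_hom_product: "proj \<in> hom D (product_group T (\<lambda>_. G))"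
  by (rule homI) (auto simp: D_FZ D_mult)

sublocale C: group C
proof -
  interpret P: group_hom D "product_group T (\<lambda>_. G)" proj
    using proj_hom_product product_group[of T "\<lambda>_. G"] is_group
    by (simp add: group_hom_def group_hom_axioms_def D.is_group)
  show "group C"
    unfolding Cgroup_def by (rule subgroup.subgroup_is_group[OF P.img_is_subgroup P.H.is_group])
qed

sublocale proj: group_hom D C proj
  using proj_hom_product
  by unfold_locales (auto simp: hom_def carrier_C C_mult D_mult)

text \<open>
  The presentations of an element of \<open>\<C>(G,T)\<close> are its lifts to \<open>\<D>(G,T)\<close>.
\<close>

definition lift_cost where
  "lift_cost g c \<longleftrightarrow> (\<exists>w\<in>carrier D. proj w = g \<and> lim_norm w = c)"

lemma Cnorm_eq_Inf: "Cnorm G nrm T g = Inf {c. lift_cost g c}"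
proof -
  have "{lim_norm w | w. w \<in> carrier D \<and> proj w = g} = {c. lift_cost g c}"
    by (auto simp: lift_cost_def)
  then show ?thesis by (simp only: Cnorm_def)
qed

sublocale lift: group_cost C lift_cost
proof
  show "\<exists>c. lift_cost g c" if "g \<in> carrier C" for g
    using that by (auto simp: lift_cost_def carrier_C)
  show "0 \<le> c" if "lift_cost g c" for g c
    using that D.pn_nonneg by (auto simp: lift_cost_def)
  show "lift_cost \<one>\<^bsub>C\<^esub> 0"
    unfolding lift_cost_def using proj.hom_one D.pn_one D.one_closed by metis
  show "lift_cost (inv\<^bsub>C\<^esub> g) c" if "lift_cost g c" for g c
    using that unfolding lift_cost_def using proj.hom_inv D.pn_inv D.inv_closed by metis
  show "\<exists>e\<le>c + d. lift_cost (g \<otimes>\<^bsub>C\<^esub> h) e" if "lift_cost g c" "lift_cost h d" for g h c d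
    using that unfolding lift_cost_def using proj.hom_mult D.pn_mult D.m_closed by metis
  show "lift_cost (h \<otimes>\<^bsub>C\<^esub> g \<otimes>\<^bsub>C\<^esub> inv\<^bsub>C\<^esub> h) c" if hg: "h \<in> carrier C" "lift_cost g c" for g h c
  proof -
    obtain v where v: "v \<in> carrier D" "proj v = g" "lim_norm v = c"
      using hg(2) unfolding lift_cost_def by blast
    obtain w where w: "w \<in> carrier D" "h = proj w"
      using hg(1) unfolding carrier_C by blast
    have "proj (w \<otimes>\<^bsub>D\<^esub> v \<otimes>\<^bsub>D\<^esub> inv\<^bsub>D\<^esub> w) = h \<otimes>\<^bsub>C\<^esub> g \<otimes>\<^bsub>C\<^esub> inv\<^bsub>C\<^esub> h"
        "lim_norm (w \<otimes>\<^bsub>D\<^esub> v \<otimes>\<^bsub>D\<^esub> inv\<^bsub>D\<^esub> w) = c" "w \<otimes>\<^bsub>D\<^esub> v \<otimes>\<^bsub>D\<^esub> inv\<^bsub>D\<^esub> w \<in> carrier D"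
      using v w by (simp_all only: proj.hom_mult proj.hom_inv D.pn_conj D.m_closed D.inv_closed)
    then show ?thesis unfolding lift_cost_def by blast
  qed
qed

sublocale C: conj_pseudonormed_group C "Cnorm G nrm T"
  using lift.pseudonorm unfolding Cnorm_eq_Inf .

lemma dcone_eq: "dcone G nrm T = C Mod nullset C (Cnorm G nrm T)"
  by (simp add: dcone_def Cnull_def nullset_def)

lemma cone_norm_eq: "cone_norm G nrm T = quotient_norm (Cnorm G nrm T)"
  by (intro ext) (simp add: cone_norm_def quotient_norm_def)

text \<open>
  A bounded function is invisible in the cone. Lifting \<open>g(t)\<close> to the single letter it labels, rescaling
  replaces the exponent \<open>1\<close> by \<open>1/t\<close>, so that the norm is at most \<open>B/t\<close>.
\<close>

lemma bounded_lift:
  assumes g: "\<And>t. t \<in> T \<Longrightarrow> g t \<in> carrier G" and B: "\<And>t. t \<in> T \<Longrightarrow> nrm (g t) \<le> B"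
  defines "w \<equiv> \<lambda>t\<in>T. FR_gen G (g t) 1"
  shows "w \<in> carrier D" and "lim_norm w = 0" and "proj w = restrict g T"
proof -
  have resc: "rescaled w t = FR_gen G (g t) (1 / t)" if "t \<in> T" for t
    using that g by (simp add: w_def psi_FR_gen)
  have closed: "rescaled w t \<in> carrier (FR G)" if "t \<in> T" for t
    using that g by (simp add: resc FR_gen_closed)
  have le: "FR_norm G nrm (rescaled w t) \<le> \<bar>1 / t\<bar> * B" if "t \<in> T" for t
  proof -
    have "FR_norm G nrm (rescaled w t) \<le> \<bar>1 / t\<bar> * nrm (g t)"
      unfolding resc[OF that] by (rule FR_norm_gen_le[OF nrm_nonneg g[OF that]])
    also have "\<dots> \<le> \<bar>1 / t\<bar> * B" using B[OF that] by (intro mult_left_mono) auto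
    finally show ?thesis .
  qed
  have bound: "((\<lambda>t. \<bar>1 / t\<bar> * B) \<longlongrightarrow> 0) (along T)"
  proof (rule filterlim_mono[OF _ order_refl inf_le1])
    have "((\<lambda>t. 1 / t) \<longlongrightarrow> (0::real)) at_top"
      using tendsto_inverse_0_at_top[OF filterlim_ident] by (simp add: inverse_eq_divide)
    then show "((\<lambda>t. \<bar>1 / t\<bar> * B) \<longlongrightarrow> 0) at_top"
      by (intro tendsto_mult_left_zero tendsto_rabs_zero)
  qed
  have lim: "((\<lambda>t. FR_norm G nrm (rescaled w t)) \<longlongrightarrow> 0) (along T)"
  proof (rule tendsto_sandwich[OF _ _ tendsto_const bound])
    show "eventually (\<lambda>t. 0 \<le> FR_norm G nrm (rescaled w t)) (along T)"
      by (rule eventually_along_mem) (rule FR.pn_nonneg[OF closed])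
    show "eventually (\<lambda>t. FR_norm G nrm (rescaled w t) \<le> \<bar>1 / t\<bar> * B) (along T)"
      by (rule eventually_along_mem) (rule le)
  qed
  then show "lim_norm w = 0" by (rule lim_norm_eqI)
  show "w \<in> carrier D"
    unfolding carrier_D using FR.cauchy_along_null[OF lim closed] g by (simp add: w_def FZ_gen)
  show "proj w = restrict g T"
    using g by (auto simp: w_def piG_gen cong: restrict_cong)
qed

end

section \<open>Maps between cones\<close>

text \<open>
  Again \<open>\<phi>\<close> is only a map of sets, as it may be a section. It acts on \<open>\<D>(G,T)\<close> by relabelling letters at
  each time \<open>t\<close>; on \<open>\<C>(G,T)\<close> it need not act.
\<close>

locale cone_morphism =
  G: directional_cone G nG T + H: directional_cone H nH T
  for G :: "('a, 'm) monoid_scheme" and nG :: "'a \<Rightarrow> real"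
    and H :: "('b, 'k) monoid_scheme" and nH :: "'b \<Rightarrow> real" and T :: "real set" +
  fixes \<phi> :: "'a \<Rightarrow> 'b" and a :: real
  assumes \<phi>: "\<phi> \<in> carrier G \<rightarrow> carrier H"
    and a_nonneg: "0 \<le> a"
    and norm_le: "g \<in> carrier G \<Longrightarrow> nH (\<phi> g) \<le> a * nG g"
begin

definition push where "push w = (\<lambda>t\<in>T. FR_map H \<phi> (w t))"

sublocale FR: group_hom "FR G" "FR H" "FR_map H \<phi>"
  by (rule FR_map_group_hom[OF \<phi>])

lemma FR_norm_le:
  "x \<in> carrier (FR G) \<Longrightarrow> FR_norm H nH (FR_map H \<phi> x) \<le> a * FR_norm G nG x"
  using FR_map_norm_le[OF \<phi> a_nonneg, of nG nH] G.nrm_nonneg H.nrm_nonneg norm_le by metis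

lemma FR_dist_le:
  assumes "x \<in> carrier (FR G)" "y \<in> carrier (FR G)"
  shows "nrm_dist (FR H) (FR_norm H nH) (FR_map H \<phi> x) (FR_map H \<phi> y)
           \<le> a * nrm_dist (FR G) (FR_norm G nG) x y"
proof -
  have "inv\<^bsub>FR H\<^esub> FR_map H \<phi> x \<otimes>\<^bsub>FR H\<^esub> FR_map H \<phi> y = FR_map H \<phi> (inv\<^bsub>FR G\<^esub> x \<otimes>\<^bsub>FR G\<^esub> y)"
    using assms by simp
  then show ?thesis using FR_norm_le[of "inv\<^bsub>FR G\<^esub> x \<otimes>\<^bsub>FR G\<^esub> y"] assms by (simp add: nrm_dist_def)
qed

lemma rescaled_push:
  "w \<in> carrier G.D \<Longrightarrow> t \<in> T \<Longrightarrow> H.rescaled (push w) t = FR_map H \<phi> (G.rescaled w t)"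
  by (simp add: push_def FR_map_psi[OF \<phi>] FZ_subset_FR G.D_FZ)

lemma push_closed:
  assumes w: "w \<in> carrier G.D"
  shows "push w \<in> carrier H.D"
proof -
  have "cauchy_along (FR H) (FR_norm H nH) T (\<lambda>t. FR_map H \<phi> (G.rescaled w t))"
    unfolding cauchy_along_def
  proof (intro allI impI)
    \<comment> \<open>The denominator is \<open>a + 1\<close> since \<open>a\<close> may be zero.\<close>
    fix \<epsilon> :: real assume "0 < \<epsilon>"
    then have "0 < \<epsilon> / (a + 1)" using a_nonneg by simp
    moreover have "cauchy_along (FR G) (FR_norm G nG) T (G.rescaled w)" using w by (simp only: G.carrier_D)
    ultimately obtain t\<^sub>0 where t0: "\<And>t t'. t \<in> T \<Longrightarrow> t' \<in> T \<Longrightarrow> t\<^sub>0 \<le> t \<Longrightarrow> t\<^sub>0 \<le> t' \<Longrightarrow>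
        nrm_dist (FR G) (FR_norm G nG) (G.rescaled w t) (G.rescaled w t') < \<epsilon> / (a + 1)"
      using cauchy_alongE by blast
    have "nrm_dist (FR H) (FR_norm H nH) (FR_map H \<phi> (G.rescaled w t)) (FR_map H \<phi> (G.rescaled w t')) < \<epsilon>"
      if t: "t \<in> T" "t' \<in> T" "t\<^sub>0 \<le> t" "t\<^sub>0 \<le> t'" for t t'
    proof -
      let ?d = "nrm_dist (FR G) (FR_norm G nG) (G.rescaled w t) (G.rescaled w t')"
      note r = G.rescaled_closed[OF w t(1)] G.rescaled_closed[OF w t(2)]
      have "a * ?d \<le> (a + 1) * ?d" using G.FR.dist_nonneg[OF r] by (simp add: algebra_simps)
      also have "\<dots> < \<epsilon>" using t0[OF t] a_nonneg by (simp add: field_simps)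
      finally show ?thesis using FR_dist_le[OF r] by simp
    qed
    then show "\<exists>t\<^sub>0. \<forall>t\<in>T. \<forall>t'\<in>T. t\<^sub>0 \<le> t \<longrightarrow> t\<^sub>0 \<le> t' \<longrightarrow> nrm_dist (FR H) (FR_norm H nH)
        (FR_map H \<phi> (G.rescaled w t)) (FR_map H \<phi> (G.rescaled w t')) < \<epsilon>" by blast
  qed
  then have "cauchy_along (FR H) (FR_norm H nH) T (H.rescaled (push w))"
    by (rule cauchy_along_cong[THEN iffD2, rotated]) (rule rescaled_push[OF w])
  then show ?thesis
    unfolding H.carrier_D using G.D_FZ[OF w] FR_map_FZ[OF \<phi>] by (simp add: push_def)
qed

lemma lim_norm_push:
  assumes w: "w \<in> carrier G.D"
  shows "H.lim_norm (push w) \<le> a * G.lim_norm w"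
proof (rule tendsto_le[OF along_not_bot[OF G.scaling] tendsto_mult_left[OF G.lim_norm_tendsto[OF w]]
        H.lim_norm_tendsto[OF push_closed[OF w]]])
  show "eventually (\<lambda>t. FR_norm H nH (H.rescaled (push w) t) \<le> a * FR_norm G nG (G.rescaled w t)) (along T)"
    by (rule eventually_along_mem) (simp only: rescaled_push[OF w] FR_norm_le G.rescaled_closed[OF w])
qed

lemma proj_push:
  assumes "\<phi> \<in> hom G H" and w: "w \<in> carrier G.D"
  shows "H.proj (push w) = restrict (\<phi> \<circ> G.proj w) T"
  using piG_natural[OF G.is_group H.is_group assms(1) G.D_FZ[OF w]]
  by (auto simp: push_def cong: restrict_cong)

end

section \<open>Extensions with bounded kernel\<close>

text \<open>
  Pushing lifts forward along \<open>\<pi>\<close> gives the upper bound. For the lower bound, let \<open>v\<close> be a lift of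
  \<open>\<pi> \<circ> g\<close>. Relabelling \<open>v\<close> by the section \<open>\<sigma>\<close> gives a lift, not of \<open>g\<close>, but of some function which agrees
  with \<open>g\<close> after applying \<open>\<pi>\<close>. The two differ by a function with values in the kernel, which is
  bounded and hence has a lift of norm zero. Multiplying by that lift corrects \<open>\<sigma>\<close> at no cost. The same relabelling
  proves surjectivity.
\<close>

lemma bounded_kernel_epi:
  fixes G :: "('a, 'm) monoid_scheme" and H :: "('b, 'k) monoid_scheme"
  assumes \<pi>: "\<pi> \<in> hom G H" and push: "cone_morphism G nG H nH T \<pi> a"
    and lift: "cone_morphism H nH G nG T \<sigma> b"
    and sec: "\<And>h. h \<in> carrier H \<Longrightarrow> \<pi> (\<sigma> h) = h"
    and B: "\<And>g. g \<in> carrier G \<Longrightarrow> \<pi> g = \<one>\<^bsub>H\<^esub> \<Longrightarrow> nG g \<le> B"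
  shows "pseudonormed_epi (Cgroup G nG T) (Cnorm G nG T) (Cgroup H nH T) (Cnorm H nH T)
           (\<lambda>g. restrict (\<pi> \<circ> g) T) a b"
proof -
  interpret P: cone_morphism G nG H nH T \<pi> a by (rule push)
  interpret L: cone_morphism H nH G nG T \<sigma> b by (rule lift)
  interpret \<pi>: group_hom G H \<pi>
    using \<pi> by (simp add: group_hom_def group_hom_axioms_def P.G.is_group P.H.is_group)
  let ?f = "\<lambda>g. restrict (\<pi> \<circ> g) T"
  have proj_push: "P.H.proj (P.push w) = ?f (P.G.proj w)" if "w \<in> carrier P.G.D" for w
    by (rule P.proj_push[OF \<pi> that])
  have proj_lift: "?f (P.G.proj (L.push v)) = P.H.proj v" if v: "v \<in> carrier P.H.D" for v
  proof -
    have "P.push (L.push v) t = v t" if t: "t \<in> T" for t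
      using t FR_map_section[OF L.\<phi> P.\<phi> sec FZ_subset_FR[OF P.H.D_FZ[OF v t]]]
      by (simp add: P.push_def L.push_def)
    then have "P.H.proj (P.push (L.push v)) = P.H.proj v" by (auto cong: restrict_cong)
    then show ?thesis using proj_push[OF L.push_closed[OF v]] by simp
  qed
  have C_closed: "g t \<in> carrier G" if "g \<in> carrier P.G.C" "t \<in> T" for g t
    using that P.G.D_FZ by (auto simp: P.G.carrier_C)
  have f_closed: "?f g \<in> carrier P.H.C" if g: "g \<in> carrier P.G.C" for g
  proof -
    obtain w where w: "w \<in> carrier P.G.D" "g = P.G.proj w" using g by (auto simp: P.G.carrier_C)
    then show ?thesis unfolding P.H.carrier_C w(2) proj_push[OF w(1), symmetric]
      using P.push_closed by blast
  qed
  have f_hom: "?f \<in> hom P.G.C P.H.C"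
  proof (rule homI)
    fix g h assume gh: "g \<in> carrier P.G.C" "h \<in> carrier P.G.C"
    show "?f (g \<otimes>\<^bsub>P.G.C\<^esub> h) = ?f g \<otimes>\<^bsub>P.H.C\<^esub> ?f h"
      using C_closed[OF gh(1)] C_closed[OF gh(2)]
      by (auto simp: P.G.C_mult P.H.C_mult cong: restrict_cong)
  qed (rule f_closed)
  have surj: "carrier P.H.C \<subseteq> ?f ` carrier P.G.C"
  proof
    fix h assume "h \<in> carrier P.H.C"
    then obtain v where v: "v \<in> carrier P.H.D" "h = P.H.proj v" by (auto simp: P.H.carrier_C)
    then have "h = ?f (P.G.proj (L.push v))" by (simp only: proj_lift)
    moreover have "P.G.proj (L.push v) \<in> carrier P.G.C"
      unfolding P.G.carrier_C using L.push_closed[OF v(1)] by blast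
    ultimately show "h \<in> ?f ` carrier P.G.C" by blast
  qed
  have lift_cost: "\<exists>d\<le>b * c. P.G.lift_cost g d"
    if g: "g \<in> carrier P.G.C" and c: "P.H.lift_cost (?f g) c" for g c
  proof -
    obtain v where v: "v \<in> carrier P.H.D" "P.H.proj v = ?f g" "P.H.lim_norm v = c"
      using c unfolding P.H.lift_cost_def by blast
    let ?w = "L.push v"
    have w: "?w \<in> carrier P.G.D" by (rule L.push_closed[OF v(1)])
    \<comment> \<open>The kernel-valued function by which the lift through \<open>\<sigma>\<close> misses \<open>g\<close>.\<close>
    define k where "k = (\<lambda>t. inv\<^bsub>G\<^esub> (P.G.proj ?w t) \<otimes>\<^bsub>G\<^esub> g t)"
    have wt: "P.G.proj ?w t \<in> carrier G" if "t \<in> T" for t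
      using that P.G.D_FZ[OF w] by simp
    have k: "k t \<in> carrier G" "P.G.proj ?w t \<otimes>\<^bsub>G\<^esub> k t = g t" if "t \<in> T" for t
      unfolding k_def using wt[OF that] C_closed[OF g that] by (simp_all del: restrict_apply restrict_apply')
    have "\<pi> (k t) = \<one>\<^bsub>H\<^esub>" if t: "t \<in> T" for t
    proof -
      have "\<pi> (P.G.proj ?w t) = \<pi> (g t)"
        using fun_cong[OF trans[OF proj_lift[OF v(1)] v(2)], of t] t by simp
      then show ?thesis unfolding k_def
        using wt[OF t] C_closed[OF g t] by (simp del: restrict_apply restrict_apply')
    qed
    then have kB: "nG (k t) \<le> B" if "t \<in> T" for t using B k(1) that by blast
    define u where "u = (\<lambda>t\<in>T. FR_gen G (k t) 1)"
    have u: "u \<in> carrier P.G.D" "P.G.lim_norm u = 0" "P.G.proj u = restrict k T"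
      unfolding u_def using P.G.bounded_lift[of k B, OF k(1) kB] by blast+
    have "P.G.proj (?w \<otimes>\<^bsub>P.G.D\<^esub> u) = P.G.proj ?w \<otimes>\<^bsub>P.G.C\<^esub> restrict k T"
      unfolding u(3)[symmetric] by (rule P.G.proj.hom_mult[OF w u(1)])
    also have "\<dots> = restrict g T"
      unfolding P.G.C_mult using k(2) by (intro restrict_ext) (simp del: comp_apply)
    also have "\<dots> = g" using g by (auto simp: P.G.carrier_C)
    finally have "P.G.lift_cost g (P.G.lim_norm (?w \<otimes>\<^bsub>P.G.D\<^esub> u))"
      unfolding P.G.lift_cost_def using P.G.D.m_closed[OF w u(1)] by blast
    moreover have "P.G.lim_norm (?w \<otimes>\<^bsub>P.G.D\<^esub> u) \<le> b * c"
      using P.G.D.pn_mult[OF w u(1)] u(2) L.lim_norm_push[OF v(1)] v(3) by simp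
    ultimately show ?thesis by blast
  qed
  show ?thesis
  proof (unfold_locales)
    show "?f \<in> epi P.G.C P.H.C" using f_hom surj by (simp add: epi_iff_subset)
  next
    fix g assume g: "g \<in> carrier P.G.C"
    show "Cnorm H nH T (?f g) \<le> a * Cnorm G nG T g"
      unfolding P.G.Cnorm_eq_Inf
    proof (rule P.G.lift.Inf_cost_mono[OF g P.a_nonneg])
      fix c assume "P.G.lift_cost g c"
      then obtain w where w: "w \<in> carrier P.G.D" "P.G.proj w = g" "P.G.lim_norm w = c"
        unfolding P.G.lift_cost_def by blast
      have "P.H.lift_cost (?f g) (P.H.lim_norm (P.push w))"
        unfolding P.H.lift_cost_def w(2)[symmetric]
        using P.push_closed[OF w(1)] proj_push[OF w(1)] by blast
      then have "Cnorm H nH T (?f g) \<le> P.H.lim_norm (P.push w)"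
        unfolding P.H.Cnorm_eq_Inf by (rule P.H.lift.Inf_cost_le)
      then show "Cnorm H nH T (?f g) \<le> a * c" using P.lim_norm_push[OF w(1)] w(3) by simp
    qed
    show "Cnorm G nG T g \<le> b * Cnorm H nH T (?f g)"
      unfolding P.H.Cnorm_eq_Inf
    proof (rule P.H.lift.Inf_cost_mono[OF f_closed[OF g] L.a_nonneg])
      fix c assume "P.H.lift_cost (?f g) c"
      then obtain d where "d \<le> b * c" "P.G.lift_cost g d" using lift_cost[OF g] by blast
      then show "Cnorm G nG T g \<le> b * c"
        unfolding P.G.Cnorm_eq_Inf using P.G.lift.Inf_cost_le by fastforce
    qed
  qed
qed

lemma cone_map_eq:
  "cone_map H nH T \<phi> = quotient_map (Cgroup H nH T) (Cnorm H nH T) (\<lambda>g. restrict (\<phi> \<circ> g) T)"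
  by (intro ext) (simp add: cone_map_def quotient_map_def cone_class_def Cnull_def nullset_def)

text \<open>
  A Lipschitz constant in the sense of the metric may be negative if the metric vanishes; the
  maximum with \<open>0\<close> makes it usable as a factor for pseudonorms.
\<close>

lemma lipschitz_norm_bound:
  assumes "conj_normed_group G nG" "group H" and f: "f \<in> carrier G \<rightarrow> carrier H" "f \<one>\<^bsub>G\<^esub> = \<one>\<^bsub>H\<^esub>"
    and lip: "\<And>x y. x \<in> carrier G \<Longrightarrow> y \<in> carrier G \<Longrightarrow> nrm_dist H nH (f x) (f y) \<le> C * nrm_dist G nG x y"
    and x: "x \<in> carrier G"
  shows "nH (f x) \<le> max C 0 * nG x"
proof -
  interpret G: conj_normed_group G nG by fact
  interpret H: group H by fact
  have fx: "f x \<in> carrier H" using f x by blast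
  have "nH (f x) \<le> C * nG x"
    using lip[OF G.one_closed x] x fx by (simp add: nrm_dist_def f(2))
  also have "\<dots> \<le> max C 0 * nG x" using G.nrm_nonneg[OF x] by (intro mult_right_mono) auto
  finally show ?thesis .
qed

theorem theorem1p8:
  fixes N :: "('n, 'p) monoid_scheme" and nN :: "'n \<Rightarrow> real"
    and G :: "('a, 'q) monoid_scheme" and nG :: "'a \<Rightarrow> real"
    and H :: "('b, 'r) monoid_scheme" and nH :: "'b \<Rightarrow> real"
    and \<iota> :: "'n \<Rightarrow> 'a" and \<pi> :: "'a \<Rightarrow> 'b"
  assumes "conj_normed_group N nN" and "conj_normed_group G nG" and "conj_normed_group H nH"
    and "\<iota> \<in> mon N G" and "\<pi> \<in> epi G H" and "\<iota> ` carrier N = kernel G H \<pi>"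
    and "lipschitz_on_groups G nG H nH \<pi>"
  shows
    "((\<exists>B. \<forall>n\<in>carrier N. nG (\<iota> n) \<le> B) \<and>
      (\<exists>s. lipschitz_on_groups H nH G nG s \<and> (\<forall>h\<in>carrier H. \<pi> (s h) = h)) \<longrightarrow>
        bilipschitz_equivalence (dcone G nG {0<..}) (cone_norm G nG {0<..})
          (dcone H nH {0<..}) (cone_norm H nH {0<..}) (cone_map H nH {0<..} \<pi>) \<and>
        cone_map H nH {0<..} \<pi> \<in> iso (dcone G nG {0<..}) (dcone H nH {0<..})) \<and>
     ((\<forall>h\<in>carrier H. nH h = Inf {nG g | g. g \<in> carrier G \<and> \<pi> g = h}) \<and>
      (\<exists>B. \<forall>n\<in>carrier N. nG (\<iota> n) \<le> B) \<longrightarrow>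
        isometry_of_groups (dcone G nG {0<..}) (cone_norm G nG {0<..})
          (dcone H nH {0<..}) (cone_norm H nH {0<..}) (cone_map H nH {0<..} \<pi>))"
proof -
  let ?T = "{0<..} :: real set"
  interpret G: directional_cone G nG ?T
    using assms(2) scaling_set_pos by (simp add: directional_cone_def directional_cone_axioms_def)
  interpret H: directional_cone H nH ?T
    using assms(3) scaling_set_pos by (simp add: directional_cone_def directional_cone_axioms_def)
  have hom: "\<pi> \<in> hom G H" and surj: "\<pi> ` carrier G = carrier H" using assms(5) by (auto simp: epi_def)
  have \<pi>_fun: "\<pi> \<in> carrier G \<rightarrow> carrier H" using hom by (simp add: hom_def)
  interpret \<pi>: group_hom G H \<pi>
    using hom by (simp add: group_hom_def group_hom_axioms_def G.is_group H.is_group)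
  let ?f = "\<lambda>g. restrict (\<pi> \<circ> g) ?T"
  have epi: "pseudonormed_epi G.C (Cnorm G nG ?T) H.C (Cnorm H nH ?T) ?f a b"
    if bounded: "\<exists>B. \<forall>n\<in>carrier N. nG (\<iota> n) \<le> B"
      and a: "0 \<le> a" "\<And>g. g \<in> carrier G \<Longrightarrow> nH (\<pi> g) \<le> a * nG g"
      and b: "0 \<le> b" "\<And>h. h \<in> carrier H \<Longrightarrow> \<exists>g\<in>carrier G. \<pi> g = h \<and> nG g \<le> b * nH h" for a b
  proof -
    obtain B where B: "\<And>n. n \<in> carrier N \<Longrightarrow> nG (\<iota> n) \<le> B" using bounded by blast
    have ker: "nG g \<le> B" if "g \<in> carrier G" "\<pi> g = \<one>\<^bsub>H\<^esub>" for g
    proof -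
      have "g \<in> \<iota> ` carrier N" using that unfolding assms(6) kernel_def by simp
      then show ?thesis using B by blast
    qed
    obtain \<sigma> where \<sigma>: "\<And>h. h \<in> carrier H \<Longrightarrow> \<sigma> h \<in> carrier G \<and> \<pi> (\<sigma> h) = h \<and> nG (\<sigma> h) \<le> b * nH h"
      using b(2) by metis
    show ?thesis
    proof (rule bounded_kernel_epi[OF hom])
      show "cone_morphism G nG H nH ?T \<pi> a"
        using a \<pi>_fun
        by (intro cone_morphism.intro cone_morphism_axioms.intro G.directional_cone_axioms H.directional_cone_axioms) auto
      show "cone_morphism H nH G nG ?T \<sigma> b"
        using b(1) \<sigma>
        by (intro cone_morphism.intro cone_morphism_axioms.intro G.directional_cone_axioms H.directional_cone_axioms) auto
      show "\<pi> (\<sigma> h) = h" if "h \<in> carrier H" for h using \<sigma>[OF that] by blast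
    qed (rule ker)
  qed
  note cone_eqs = G.dcone_eq H.dcone_eq G.cone_norm_eq H.cone_norm_eq cone_map_eq
  have part_a: "bilipschitz_equivalence (dcone G nG ?T) (cone_norm G nG ?T)
          (dcone H nH ?T) (cone_norm H nH ?T) (cone_map H nH ?T \<pi>) \<and>
        cone_map H nH ?T \<pi> \<in> iso (dcone G nG ?T) (dcone H nH ?T)"
    if bounded: "\<exists>B. \<forall>n\<in>carrier N. nG (\<iota> n) \<le> B"
      and s: "lipschitz_on_groups H nH G nG s" "\<And>h. h \<in> carrier H \<Longrightarrow> \<pi> (s h) = h" for s
  proof -
    obtain a where a: "\<And>x y. x \<in> carrier G \<Longrightarrow> y \<in> carrier G \<Longrightarrow>
        nrm_dist H nH (\<pi> x) (\<pi> y) \<le> a * nrm_dist G nG x y"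
      using assms(7) unfolding lipschitz_on_groups_def by blast
    obtain b where b: "\<And>x y. x \<in> carrier H \<Longrightarrow> y \<in> carrier H \<Longrightarrow>
        nrm_dist G nG (s x) (s y) \<le> b * nrm_dist H nH x y"
      using s(1) unfolding lipschitz_on_groups_def by blast
    have s_closed: "s h \<in> carrier G" if "h \<in> carrier H" for h
      using that s(1) unfolding lipschitz_on_groups_def by blast
    \<comment> \<open>A Lipschitz section need not send \<open>1\<close> to \<open>1\<close>, so its Lipschitz constant does not bound norms.
      Translating by \<open>s(1)\<^sup>-\<^sup>1\<close>, an element of the kernel, gives a section which does.\<close>
    define \<sigma> where "\<sigma> h = inv\<^bsub>G\<^esub> s \<one>\<^bsub>H\<^esub> \<otimes>\<^bsub>G\<^esub> s h" for h
    have \<sigma>: "\<sigma> h \<in> carrier G" "\<pi> (\<sigma> h) = h" if "h \<in> carrier H" for h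
      using that s_closed s(2) by (simp_all add: \<sigma>_def)
    have "nG (\<sigma> h) \<le> max b 0 * nH h" if h: "h \<in> carrier H" for h
    proof -
      have "nG (\<sigma> h) \<le> b * nH h"
        using b[OF H.one_closed h] h by (simp add: nrm_dist_def \<sigma>_def)
      also have "\<dots> \<le> max b 0 * nH h" using H.nrm_nonneg[OF h] by (intro mult_right_mono) auto
      finally show ?thesis .
    qed
    then interpret pseudonormed_epi G.C "Cnorm G nG ?T" H.C "Cnorm H nH ?T" ?f "max a 0" "max b 0"
      using \<sigma> lipschitz_norm_bound[OF assms(2) H.is_group \<pi>_fun \<pi>.hom_one a]
      by (intro epi[OF bounded]) auto
    show ?thesis unfolding cone_eqs using quotient_map_bilipschitz quotient_map_iso by blast
  qed
  have part_b: "isometry_of_groups (dcone G nG ?T) (cone_norm G nG ?T)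
          (dcone H nH ?T) (cone_norm H nH ?T) (cone_map H nH ?T \<pi>)"
    if quot: "\<And>h. h \<in> carrier H \<Longrightarrow> nH h = Inf {nG g | g. g \<in> carrier G \<and> \<pi> g = h}"
      and bounded: "\<exists>B. \<forall>n\<in>carrier N. nG (\<iota> n) \<le> B"
  proof -
    have bdd: "bdd_below {nG g | g. g \<in> carrier G \<and> \<pi> g = h}" for h
      using G.nrm_nonneg by (intro bdd_belowI[of _ 0]) auto
    have upper: "nH (\<pi> g) \<le> 1 * nG g" if g: "g \<in> carrier G" for g
    proof -
      have "nH (\<pi> g) = Inf {nG x | x. x \<in> carrier G \<and> \<pi> x = \<pi> g}" using g by (intro quot) simp
      also have "\<dots> \<le> nG g" using g by (intro cInf_lower bdd) blast
      finally show ?thesis by simp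
    qed
    \<comment> \<open>Infima are only approached, so the section has a constant \<open>b > 1\<close>. At \<open>h = 1\<close> there is no room for
      an error; there \<open>1\<close> itself is a preimage of minimal norm.\<close>
    have near: "\<exists>g\<in>carrier G. \<pi> g = h \<and> nG g \<le> b * nH h" if h: "h \<in> carrier H" and b: "1 < b" for h b
    proof (cases "h = \<one>\<^bsub>H\<^esub>")
      case True
      then show ?thesis using G.nrm_eq_0_iff[OF G.one_closed] H.nrm_eq_0_iff[OF H.one_closed]
        by (intro bexI[of _ "\<one>\<^bsub>G\<^esub>"]) auto
    next
      case False
      then have "0 < nH h" using H.nrm_nonneg[OF h] H.nrm_eq_0_iff[OF h] by simp
      then have "Inf {nG g | g. g \<in> carrier G \<and> \<pi> g = h} < b * nH h"
        unfolding quot[OF h, symmetric] using b by simp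
      moreover have "{nG g | g. g \<in> carrier G \<and> \<pi> g = h} \<noteq> {}"
        using h unfolding surj[symmetric] by blast
      ultimately obtain x where "x \<in> {nG g | g. g \<in> carrier G \<and> \<pi> g = h}" "x < b * nH h"
        by (meson cInf_lessD)
      then obtain g where "g \<in> carrier G" "\<pi> g = h" "nG g < b * nH h" by blast
      then show ?thesis by (intro bexI[of _ g]) auto
    qed
    have epi_b: "pseudonormed_epi G.C (Cnorm G nG ?T) H.C (Cnorm H nH ?T) ?f 1 b" if "1 < b" for b
      using upper near that by (intro epi[OF bounded]) auto
    interpret pseudonormed_epi G.C "Cnorm G nG ?T" H.C "Cnorm H nH ?T" ?f 1 2
      by (rule epi_b) simp
    have "Cnorm H nH ?T (?f g) = Cnorm G nG ?T g" if g: "g \<in> carrier G.C" for g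
    proof (rule order_antisym)
      show "Cnorm H nH ?T (?f g) \<le> Cnorm G nG ?T g" using upper[OF g] by simp
      let ?m = "Cnorm H nH ?T (?f g)"
      have m: "0 \<le> ?m" by (rule H.C.pn_nonneg) (rule hom.hom_closed[OF g])
      show "Cnorm G nG ?T g \<le> ?m"
      proof (rule field_le_epsilon)
        fix \<epsilon> :: real assume e: "0 < \<epsilon>"
        \<comment> \<open>\<open>b\<close> is chosen such that \<open>(b - 1) ?m \<le> \<epsilon>\<close>, where \<open>?m\<close> may be zero.\<close>
        have "Cnorm G nG ?T g \<le> (1 + \<epsilon> / (?m + 1)) * ?m"
          using pseudonormed_epi.lower[OF epi_b[of "1 + \<epsilon> / (?m + 1)"] g] e m by simp
        also have "\<dots> = ?m + \<epsilon> * (?m / (?m + 1))" by (simp add: algebra_simps)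
        also have "\<epsilon> * (?m / (?m + 1)) \<le> \<epsilon> * 1" using e m by (intro mult_left_mono) auto
        finally show "Cnorm G nG ?T g \<le> ?m + \<epsilon>" by (simp only: mult_1_right)
      qed
    qed
    then show ?thesis unfolding cone_eqs by (rule quotient_map_isometry)
  qed
  show ?thesis using part_a part_b by blast
qed

end
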